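(* Let $d\ge 2$, $0<\alpha<d$ and $1<p<q<\infty$. Then there is a constant $N=N(d,\alpha,p,q)$ such that for every $b\in \dot E_{q,\alpha}$ and every $f\in L_p(\mathbb{R}^d)$ $$\|b\,P_\alpha f\|_{L_p(\mathbb{R}^d)}\le N\,\|b\|_{\dot E_{q,\alpha}}\,\|f\|_{L_p(\mathbb{R}^d)}.$$
   Context: Functions are real-valued and measurable on $\mathbb{R}^d$. $B_\rho(x)=\{y\in\mathbb{R}^d:|y-x|<\rho\}$, and $\mathbb{B}_\rho$ is the collection of all balls $B_\rho(x)$, $x\in\mathbb{R}^d$. For a measurable set $\Gamma\subset\mathbb{R}^d$ of finite positive volume $|\Gamma|$, the normalized norm is $$⦀f⦀_{L_q(\Gamma)}:=\Big(\frac1{|\Gamma|}\int_\Gamma |f|^q\,dx\Big)^{1/q}.$$ For $\beta\ge 0$ and $q\in[1,\infty)$, the (homogeneous) Morrey space $\dot E_{q,\beta}$ is the set of functions $f$ with $$\|f\|_{\dot E_{q,\beta}}:=\sup_{\rho>0}\rho^\beta\sup_{B\in\mathbb{B}_\rho}⦀f⦀_{L_q(B)}<\infty.$$ For $0<\alpha<d$ the Riesz potential is $$P_\alpha f(x)=\int_{\mathbb{R}^d}\frac{f(y)}{|x-y|^{d-\alpha}}\,dy .$$ The product $bP_\alpha f$ is understood as $0$ at points where $b=0$. (If $q>d/\alpha$, then $\dot E_{q,\alpha}=\{0\}$ up to a.e. equality and the inequality is trivial.) *)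

theory Defs
  imports "HOL-Analysis.Analysis"
begin

text \<open>Only used for exponents \<open>r > 0\<close>; then infinity is sent to infinity.\<close>

definition ennreal_powr :: "ennreal \<Rightarrow> real \<Rightarrow> ennreal" where
  "ennreal_powr t r = (if t = \<infinity> then \<infinity> else ennreal (enn2real t powr r))"

definition Lp_norm :: "real \<Rightarrow> ('a::euclidean_space \<Rightarrow> real) \<Rightarrow> ennreal" where
  "Lp_norm p f = ennreal_powr (\<integral>\<^sup>+x. ennreal (\<bar>f x\<bar> powr p) \<partial>lebesgue) (1 / p)"

definition Lp_space :: "real \<Rightarrow> ('a::euclidean_space \<Rightarrow> real) set" where
  "Lp_space p = {f \<in> borel_measurable lebesgue. Lp_norm p f < \<infinity>}"

definition normalized_norm :: "real \<Rightarrow> 'a set \<Rightarrow> ('a::euclidean_space \<Rightarrow> real) \<Rightarrow> ennreal" where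
  "normalized_norm q \<Gamma> f =
     ennreal_powr ((\<integral>\<^sup>+x\<in>\<Gamma>. ennreal (\<bar>f x\<bar> powr q) \<partial>lebesgue) / emeasure lebesgue \<Gamma>) (1 / q)"

definition morrey_norm :: "real \<Rightarrow> real \<Rightarrow> ('a::euclidean_space \<Rightarrow> real) \<Rightarrow> ennreal" where
  "morrey_norm q \<beta> f =
     (SUP \<rho>\<in>{0<..}. ennreal (\<rho> powr \<beta>) * (SUP x. normalized_norm q (ball x \<rho>) f))"

definition morrey_space :: "real \<Rightarrow> real \<Rightarrow> ('a::euclidean_space \<Rightarrow> real) set" where
  "morrey_space q \<beta> = {f \<in> borel_measurable lebesgue. morrey_norm q \<beta> f < \<infinity>}"

definition riesz_integrand :: "real \<Rightarrow> ('a::euclidean_space \<Rightarrow> real) \<Rightarrow> 'a \<Rightarrow> 'a \<Rightarrow> real" where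
  "riesz_integrand \<alpha> f x y = f y / norm (x - y) powr (real DIM('a) - \<alpha>)"

text \<open>The Bochner integral is 0 wherever it does not converge absolutely, so a claim about
  \<open>riesz_potential \<alpha> f x\<close> is meaningful only together with integrability of
  \<open>riesz_integrand \<alpha> f x\<close>.\<close>

definition riesz_potential :: "real \<Rightarrow> ('a::euclidean_space \<Rightarrow> real) \<Rightarrow> 'a \<Rightarrow> real" where
  "riesz_potential \<alpha> f x = (\<integral>y. riesz_integrand \<alpha> f x y \<partial>lebesgue)"

end

theory Submission
  imports Defs
begin

text \<open>
  The operator \<open>f \<mapsto> b P\<^sub>\<alpha> f\<close> is bounded on \<open>L\<^sub>p\<close> by Schur's test with power weights, and the weight is
  itself a Riesz potential. Let \<open>d\<close> be the dimension and scale \<open>\<beta> = \<bar>b\<bar> powr q\<close> so that the Morrey condition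
  reads \<open>\<integral>\<^bsub>B\<^esub> \<beta> \<le> \<rho> powr (d - \<alpha> q)\<close> for every ball \<open>B\<close> of radius \<open>\<rho>\<close>. Fix a small \<open>\<gamma> > 0\<close>, put
  \<open>\<mu> = \<alpha> q - \<gamma>\<close> and \<open>W = P\<^sub>\<gamma> \<beta>\<close>. Three facts about \<open>W\<close> follow from Tonelli and elementary integrals of
  the kernel: the mean of \<open>W\<close> over a ball centred at \<open>x\<close> is at most a multiple of \<open>W x\<close> (an \<open>A\<^sub>1\<close>
  condition); the mean over a ball of radius \<open>\<rho>\<close> is at most a multiple of \<open>\<rho> powr (-\<mu>)\<close>; and the mean of
  \<open>\<beta>\<close> over such a ball centred at \<open>x\<close> is at most a multiple of \<open>\<rho> powr (-\<gamma>) * W x\<close>. Morally \<open>W\<close> stands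
  for \<open>\<bar>b\<bar> powr (\<mu> / \<alpha>)\<close>, to which it is equal up to a constant if \<open>b\<close> is \<open>\<bar>x\<bar> powr (-\<alpha>)\<close> and \<open>\<alpha> q < d\<close>.
  It need not dominate that power pointwise: \<open>b\<close> enters the argument only through its ball means.

  By Hoelder's inequality the three facts bound the ball means of every product
  \<open>\<beta> powr s * W powr t\<close> with \<open>s + t < 1\<close> in two ways, one good for small and one for large radii.
  Splitting \<open>P\<^sub>\<alpha>\<close> at the radius where the two bounds agree (Hedberg's trick, lemma
  \<open>hedberg_interpolation\<close>) gives
  \<open>P\<^sub>\<alpha> (\<beta> powr s * W powr t) \<le> C * W powr ((\<alpha> q s + \<mu> t - \<alpha>) / \<mu>)\<close> (lemma \<open>riesz_potential_monomial\<close>).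
  For \<open>\<delta> > 0\<close> small, take \<open>u = W powr (\<alpha> / \<mu> + \<delta>)\<close> and \<open>v = W powr \<delta>\<close>. With \<open>(s, t) = (0, \<alpha> / \<mu> + \<delta>)\<close>
  the estimate says \<open>P\<^sub>\<alpha> u \<le> C v\<close>; with \<open>(s, t) = (p / q, (p - 1) \<delta>)\<close> it says
  \<open>P\<^sub>\<alpha> (\<beta> powr (p / q) * v powr (p - 1)) \<le> D * u powr (p - 1)\<close>. As \<open>\<beta> powr (p / q)\<close> is \<open>\<bar>b\<bar> powr p\<close> up to
  scaling, these are the two hypotheses of lemma \<open>schur_test\<close>. The gap \<open>p < q\<close> is what leaves room for
  \<open>s + t < 1\<close>, and \<open>p > 1\<close> makes the integral over large radii converge in the second estimate.
\<close>

section \<open>Hoelder's inequality and Schur's test\<close>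

lemma young_powr:
  fixes a x y :: real
  assumes "0 < a" "a < 1" "0 \<le> x" "0 \<le> y"
  shows "x powr a * y powr (1 - a) \<le> a * x + (1 - a) * y"
proof (cases "x = 0 \<or> y = 0")
  case False
  then show ?thesis using Youngs_inequality_0[of a "1 - a" x y] assms by auto
qed (use assms in auto)

text \<open>
  Hoelder's inequality in terms of upper bounds for the two integrals: dividing by these bounds
  reduces it to Young's inequality under the integral, and no power of an extended real occurs.
\<close>

lemma nn_integral_holder:
  fixes f g :: "'b \<Rightarrow> real"
  assumes [measurable]: "f \<in> borel_measurable M" "g \<in> borel_measurable M"
    and nonneg: "\<And>x. 0 \<le> f x" "\<And>x. 0 \<le> g x" and a: "0 < a" "a < 1" and "0 < A" "0 < B"
    and f: "(\<integral>\<^sup>+x. ennreal (f x) \<partial>M) \<le> ennreal A" and g: "(\<integral>\<^sup>+x. ennreal (g x) \<partial>M) \<le> ennreal B"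
  shows "(\<integral>\<^sup>+x. ennreal (f x powr a * g x powr (1 - a)) \<partial>M) \<le> ennreal (A powr a * B powr (1 - a))"
proof -
  define K where "K = A powr a * B powr (1 - a)"
  have K: "0 < K" using assms by (simp add: K_def)
  have pointwise: "f x powr a * g x powr (1 - a) \<le> K * a / A * f x + K * (1 - a) / B * g x" for x
  proof -
    have "(f x / A) powr a * (g x / B) powr (1 - a) \<le> a * (f x / A) + (1 - a) * (g x / B)"
      using assms by (intro young_powr) auto
    then have "K * ((f x / A) powr a * (g x / B) powr (1 - a)) \<le> K * (a * (f x / A) + (1 - a) * (g x / B))"
      using K by simp
    moreover have "K * ((f x / A) powr a * (g x / B) powr (1 - a)) = f x powr a * g x powr (1 - a)"
      using assms by (simp add: K_def powr_divide)
    ultimately show ?thesis by (simp add: algebra_simps)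
  qed
  have "(\<integral>\<^sup>+x. ennreal (f x powr a * g x powr (1 - a)) \<partial>M)
      \<le> (\<integral>\<^sup>+x. ennreal (K * a / A) * ennreal (f x) + ennreal (K * (1 - a) / B) * ennreal (g x) \<partial>M)"
  proof (intro nn_integral_mono)
    fix x
    show "ennreal (f x powr a * g x powr (1 - a))
        \<le> ennreal (K * a / A) * ennreal (f x) + ennreal (K * (1 - a) / B) * ennreal (g x)"
      using pointwise[of x] K assms
      by (simp add: ennreal_mult[symmetric] ennreal_plus[symmetric] ennreal_leI del: ennreal_plus)
  qed
  also have "\<dots> = ennreal (K * a / A) * (\<integral>\<^sup>+x. ennreal (f x) \<partial>M) + ennreal (K * (1 - a) / B) * (\<integral>\<^sup>+x. ennreal (g x) \<partial>M)"
    by (simp add: nn_integral_add nn_integral_cmult)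
  also have "\<dots> \<le> ennreal (K * a / A) * ennreal A + ennreal (K * (1 - a) / B) * ennreal B"
    by (intro add_mono mult_left_mono f g) auto
  also have "\<dots> = ennreal K"
    using K assms by (simp add: ennreal_mult[symmetric] ennreal_plus[symmetric] del: ennreal_plus)
      (simp add: algebra_simps)
  finally show ?thesis by (simp add: K_def)
qed

text \<open>
  The product \<open>x powr s * y powr t\<close>, with the convention that the zeroth power of \<open>x\<close> is \<open>1\<close> also at
  \<open>x = 0\<close>, where \<open>powr\<close> would give \<open>0\<close>.
\<close>

definition monomial_weight :: "real \<Rightarrow> real \<Rightarrow> real \<Rightarrow> real \<Rightarrow> real" where
  "monomial_weight s t x y = (if s = 0 then 1 else x powr s) * y powr t"

text \<open>
  The three-factor inequality with third factor \<open>1\<close>: combine \<open>f\<close> and \<open>g\<close> into the geometric mean \<open>h\<close>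
  with exponents \<open>s / (s + t)\<close> and \<open>t / (s + t)\<close>, then \<open>h\<close> and \<open>1\<close> with exponents \<open>s + t\<close> and
  \<open>1 - s - t\<close>.
\<close>

lemma set_nn_integral_holder:
  fixes f g :: "'b \<Rightarrow> real"
  assumes [measurable]: "f \<in> borel_measurable M" "g \<in> borel_measurable M" "S \<in> sets M"
    and nonneg: "\<And>x. 0 \<le> f x" "\<And>x. 0 \<le> g x" and st: "0 \<le> s" "0 < t" "s + t < 1"
    and pos: "0 < A" "0 < B" "0 < C"
    and f: "(\<integral>\<^sup>+x\<in>S. ennreal (f x) \<partial>M) \<le> ennreal A" and g: "(\<integral>\<^sup>+x\<in>S. ennreal (g x) \<partial>M) \<le> ennreal B"
    and S: "emeasure M S \<le> ennreal C"
  shows "(\<integral>\<^sup>+x\<in>S. ennreal (monomial_weight s t (f x) (g x)) \<partial>M)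
     \<le> ennreal (A powr s * B powr t * C powr (1 - s - t))"
proof -
  define u where "u = s + t"
  have u: "0 < u" "u < 1" using st by (auto simp: u_def)
  define h where "h x = (if s = 0 then g x else f x powr (s / u) * g x powr (t / u)) * indicator S x" for x
  define D where "D = A powr (s / u) * B powr (t / u)"
  have [measurable]: "h \<in> borel_measurable M" unfolding h_def by measurable
  have tu: "t / u = 1 - s / u" using u by (simp add: u_def field_simps)
  have fS: "(\<integral>\<^sup>+x. ennreal (f x * indicator S x) \<partial>M) \<le> ennreal A"
    and gS: "(\<integral>\<^sup>+x. ennreal (g x * indicator S x) \<partial>M) \<le> ennreal B"
    using f g by (simp_all add: nn_integral_set_ennreal)
  have "(\<integral>\<^sup>+x. ennreal (h x) \<partial>M) \<le> ennreal D"
  proof (cases "s = 0")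
    case True
    then show ?thesis using gS u pos by (simp add: h_def D_def u_def)
  next
    case False
    have "(\<integral>\<^sup>+x. ennreal ((f x * indicator S x) powr (s / u) * (g x * indicator S x) powr (1 - s / u)) \<partial>M)
        \<le> ennreal (A powr (s / u) * B powr (1 - s / u))"
      using nonneg pos st False by (intro nn_integral_holder fS gS) (auto simp: u_def)
    moreover have "h x = (f x * indicator S x) powr (s / u) * (g x * indicator S x) powr (1 - s / u)" for x
      using False by (simp add: h_def tu indicator_def)
    ultimately show ?thesis by (simp add: D_def tu)
  qed
  moreover have "(\<integral>\<^sup>+x. ennreal (indicator S x) \<partial>M) \<le> ennreal C"
    using S by (simp add: ennreal_indicator)
  ultimately have "(\<integral>\<^sup>+x. ennreal (h x powr u * indicator S x powr (1 - u)) \<partial>M) \<le> ennreal (D powr u * C powr (1 - u))"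
    using nonneg pos u by (intro nn_integral_holder) (auto simp: h_def D_def)
  also have "D powr u * C powr (1 - u) = A powr s * B powr t * C powr (1 - s - t)"
    using u pos by (simp add: D_def powr_mult powr_powr) (simp add: u_def algebra_simps)
  also have "(\<lambda>x. ennreal (h x powr u * indicator S x powr (1 - u)))
      = (\<lambda>x. ennreal (monomial_weight s t (f x) (g x)) * indicator S x)"
  proof
    fix x
    have "h x powr u = monomial_weight s t (f x) (g x)" if "x \<in> S"
      using that u st by (auto simp: h_def monomial_weight_def powr_mult powr_powr u_def)
    then show "ennreal (h x powr u * indicator S x powr (1 - u)) = ennreal (monomial_weight s t (f x) (g x)) * indicator S x"
      by (auto simp: indicator_def)
  qed
  finally show ?thesis .
qed

text \<open>
  Weighted Schur test from \<open>L\<^sub>p\<close> to \<open>L\<^sub>p\<close> with the weight \<open>h\<close> on the target. Write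
  \<open>k \<bar>f\<bar> = (k u) powr (1 - 1/p) * (k F) powr (1/p)\<close> with \<open>F = \<bar>f\<bar> powr p * u powr (1 - p)\<close>. Hoelder's inequality and
  the row condition bound the \<open>p\<close>-th power of \<open>T x = \<integral> k x y \<bar>f y\<bar> dy\<close> by \<open>(C v x) powr (p - 1)\<close> times
  \<open>S x = \<integral> k x y F y dy\<close>. Integrating against \<open>h\<close>, exchanging the integrals and applying
  the column condition cancels the powers of \<open>u\<close>. Finiteness of \<open>T\<close> where \<open>h\<close> does not vanish is a
  consequence rather than an assumption.
\<close>

lemma schur_test:
  fixes k :: "'b \<Rightarrow> 'c \<Rightarrow> real" and f u :: "'c \<Rightarrow> real" and h v :: "'b \<Rightarrow> real" and p C D :: real
  assumes "sigma_finite_measure M" "sigma_finite_measure M'"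
    and [measurable]: "(\<lambda>z. k (fst z) (snd z)) \<in> borel_measurable (M \<Otimes>\<^sub>M M')"
      "f \<in> borel_measurable M'" "u \<in> borel_measurable M'" "h \<in> borel_measurable M" "v \<in> borel_measurable M"
    and nonneg: "\<And>x y. 0 \<le> k x y" "\<And>x. 0 \<le> h x" and p: "1 < p" and CD: "0 < C" "0 < D"
    and upos: "AE y in M'. 0 < u y" and vpos: "AE x in M. 0 < v x"
    and row: "AE x in M. (\<integral>\<^sup>+y. ennreal (k x y) * ennreal (u y) \<partial>M') \<le> ennreal (C * v x)"
    and col: "AE y in M'. (\<integral>\<^sup>+x. ennreal (k x y) * ennreal (h x * v x powr (p - 1)) \<partial>M)
                \<le> ennreal (D * u y powr (p - 1))"
    and f: "(\<integral>\<^sup>+y. ennreal (\<bar>f y\<bar> powr p) \<partial>M') < \<infinity>"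
  shows "AE x in M. h x \<noteq> 0 \<longrightarrow> (\<integral>\<^sup>+y. ennreal (k x y * \<bar>f y\<bar>) \<partial>M') < \<infinity>"
    and "(\<integral>\<^sup>+x. ennreal (h x * enn2real (\<integral>\<^sup>+y. ennreal (k x y * \<bar>f y\<bar>) \<partial>M') powr p) \<partial>M)
      \<le> ennreal (C powr (p - 1) * D) * (\<integral>\<^sup>+y. ennreal (\<bar>f y\<bar> powr p) \<partial>M')"
proof -
  interpret pair_sigma_finite M M' using assms(1,2) by (rule pair_sigma_finite.intro)
  define T where "T x = (\<integral>\<^sup>+y. ennreal (k x y * \<bar>f y\<bar>) \<partial>M')" for x
  define F where "F y = \<bar>f y\<bar> powr p * u y powr (1 - p)" for y
  define S where "S x = (\<integral>\<^sup>+y. ennreal (k x y * F y) \<partial>M')" for x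
  define m where "m x = h x * v x powr (p - 1)" for x
  have [measurable]: "F \<in> borel_measurable M'" "m \<in> borel_measurable M" unfolding F_def m_def by measurable
  have kx: "k x \<in> borel_measurable M'" if "x \<in> space M" for x
    using measurable_compose[OF measurable_Pair1'[OF that] assms(3)] by simp
  have ky: "(\<lambda>x. k x y) \<in> borel_measurable M" if "y \<in> space M'" for y
    using measurable_compose[OF measurable_Pair2'[OF that] assms(3)] by simp
  have [measurable]: "S \<in> borel_measurable M" unfolding S_def by measurable
  have Fm: "0 \<le> F y" "0 \<le> m x" for x y using nonneg by (simp_all add: F_def m_def)

  \<comment> \<open>The bound \<open>B\<close> exceeds \<open>S x\<close> by an arbitrary \<open>e > 0\<close>, because \<open>S x\<close> may vanish.\<close>
  have pointwise: "T x < \<infinity> \<and> enn2real (T x) powr p \<le> (C * v x) powr (p - 1) * enn2real (S x)"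
    if x: "x \<in> space M" and v: "0 < v x" and row: "(\<integral>\<^sup>+y. ennreal (k x y) * ennreal (u y) \<partial>M') \<le> ennreal (C * v x)"
      and S: "S x < \<infinity>" for x
  proof -
    note [measurable] = kx[OF x]
    have bound: "T x \<le> ennreal ((C * v x) powr (1 - 1 / p) * B powr (1 / p))" if B: "enn2real (S x) \<le> B" "0 < B" for B
    proof -
      have "T x = (\<integral>\<^sup>+y. ennreal ((k x y * \<bar>u y\<bar>) powr (1 - 1 / p) * (k x y * F y) powr (1 - (1 - 1 / p))) \<partial>M')"
        unfolding T_def
      proof (intro nn_integral_cong_AE)
        show "AE y in M'. ennreal (k x y * \<bar>f y\<bar>)
          = ennreal ((k x y * \<bar>u y\<bar>) powr (1 - 1 / p) * (k x y * F y) powr (1 - (1 - 1 / p)))"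
          using upos
        proof eventually_elim
          case (elim y)
          have "(k x y * \<bar>u y\<bar>) powr (1 - 1 / p) * (k x y * F y) powr (1 - (1 - 1 / p))
              = (k x y powr (1 - 1 / p) * k x y powr (1 / p)) * \<bar>f y\<bar> * (u y powr (1 - 1 / p) * u y powr ((1 - p) * (1 / p)))"
            using elim nonneg p by (simp add: F_def powr_mult powr_powr)
          also have "k x y powr (1 - 1 / p) * k x y powr (1 / p) = k x y"
            using nonneg(1)[of x y] by (simp add: powr_add[symmetric])
          also have "u y powr (1 - 1 / p) * u y powr ((1 - p) * (1 / p)) = 1"
            using elim p by (simp add: powr_add[symmetric] field_simps)
          finally show ?case by simp
        qed
      qed
      also have "\<dots> \<le> ennreal ((C * v x) powr (1 - 1 / p) * B powr (1 - (1 - 1 / p)))"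
      proof (intro nn_integral_holder)
        have "(\<integral>\<^sup>+y. ennreal (k x y * \<bar>u y\<bar>) \<partial>M') = (\<integral>\<^sup>+y. ennreal (k x y) * ennreal (u y) \<partial>M')"
          using upos by (intro nn_integral_cong_AE) (auto elim!: eventually_mono simp: ennreal_mult nonneg)
        then show "(\<integral>\<^sup>+y. ennreal (k x y * \<bar>u y\<bar>) \<partial>M') \<le> ennreal (C * v x)" using row by simp
        have "S x = ennreal (enn2real (S x))" using S by simp
        also have "\<dots> \<le> ennreal B" using B by (intro ennreal_leI)
        finally show "(\<integral>\<^sup>+y. ennreal (k x y * F y) \<partial>M') \<le> ennreal B" by (simp add: S_def)
      qed (use p CD v B nonneg Fm in auto)
      finally show ?thesis by simp
    qed
    have fin: "T x < \<infinity>"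
      using le_less_trans[OF bound[of "enn2real (S x) + 1"] ennreal_less_top] by (simp add: add_nonneg_pos)
    have "enn2real (T x) powr p \<le> (C * v x) powr (p - 1) * (enn2real (S x) + e)" if "0 < e" for e
    proof -
      have "ennreal (enn2real (T x)) \<le> ennreal ((C * v x) powr (1 - 1 / p) * (enn2real (S x) + e) powr (1 / p))"
        using bound[of "enn2real (S x) + e"] that fin by (simp add: add_nonneg_pos)
      then have "enn2real (T x) \<le> (C * v x) powr (1 - 1 / p) * (enn2real (S x) + e) powr (1 / p)"
        by (simp add: ennreal_le_iff)
      then have "enn2real (T x) powr p \<le> ((C * v x) powr (1 - 1 / p) * (enn2real (S x) + e) powr (1 / p)) powr p"
        using p by (intro powr_mono2) auto
      also have "\<dots> = (C * v x) powr ((1 - 1 / p) * p) * (enn2real (S x) + e)"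
        using that p by (simp add: powr_mult powr_powr)
      also have "(1 - 1 / p) * p = p - 1" using p by (simp add: field_simps)
      finally show ?thesis .
    qed
    note eps = this
    have "enn2real (T x) powr p \<le> (C * v x) powr (p - 1) * enn2real (S x) + e" if "0 < e" for e
    proof -
      have "0 < (C * v x) powr (p - 1)" using CD v by simp
      then show ?thesis using eps[of "e / (C * v x) powr (p - 1)"] that by (simp add: distrib_left)
    qed
    then show ?thesis using fin by (auto intro: field_le_epsilon)
  qed

  have "(\<integral>\<^sup>+x. ennreal (m x) * S x \<partial>M) = (\<integral>\<^sup>+x. \<integral>\<^sup>+y. ennreal (m x) * ennreal (k x y * F y) \<partial>M' \<partial>M)"
    unfolding S_def by (intro nn_integral_cong nn_integral_cmult[symmetric]) (auto intro!: measurable_compose[OF _ measurable_ennreal] borel_measurable_times kx)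
  also have "\<dots> = (\<integral>\<^sup>+y. \<integral>\<^sup>+x. ennreal (m x) * ennreal (k x y * F y) \<partial>M \<partial>M')"
    by (intro Fubini'[symmetric]) (unfold split_beta', measurable)
  also have "\<dots> = (\<integral>\<^sup>+y. (\<integral>\<^sup>+x. ennreal (k x y) * ennreal (m x) \<partial>M) * ennreal (F y) \<partial>M')"
    by (intro nn_integral_cong, subst nn_integral_multc[symmetric])
       (auto intro!: nn_integral_cong borel_measurable_times_ennreal measurable_compose[OF _ measurable_ennreal] ky
         simp: ennreal_mult nonneg Fm ac_simps)
  also have "\<dots> \<le> (\<integral>\<^sup>+y. ennreal D * ennreal (\<bar>f y\<bar> powr p) \<partial>M')"
  proof (intro nn_integral_mono_AE)
    show "AE y in M'. (\<integral>\<^sup>+x. ennreal (k x y) * ennreal (m x) \<partial>M) * ennreal (F y) \<le> ennreal D * ennreal (\<bar>f y\<bar> powr p)"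
      using col upos
    proof eventually_elim
      case (elim y)
      have "(\<integral>\<^sup>+x. ennreal (k x y) * ennreal (m x) \<partial>M) * ennreal (F y) \<le> ennreal (D * u y powr (p - 1)) * ennreal (F y)"
        using elim by (intro mult_right_mono) (auto simp: m_def)
      also have "\<dots> = ennreal (D * \<bar>f y\<bar> powr p * (u y powr (p - 1) * u y powr (1 - p)))"
        using CD by (simp add: F_def ennreal_mult[symmetric] ac_simps)
      also have "u y powr (p - 1) * u y powr (1 - p) = 1" using elim by (simp add: powr_add[symmetric])
      finally show ?case using CD by (simp add: ennreal_mult)
    qed
  qed
  also have "\<dots> = ennreal D * (\<integral>\<^sup>+y. ennreal (\<bar>f y\<bar> powr p) \<partial>M')" by (rule nn_integral_cmult) measurable
  finally have total: "(\<integral>\<^sup>+x. ennreal (m x) * S x \<partial>M) \<le> ennreal D * (\<integral>\<^sup>+y. ennreal (\<bar>f y\<bar> powr p) \<partial>M')" .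
  also have "\<dots> < \<infinity>" using f by (simp add: ennreal_mult_less_top)
  finally have "AE x in M. ennreal (m x) * S x \<noteq> \<infinity>" by (intro nn_integral_PInf_AE) auto
  then have AE: "AE x in M. h x \<noteq> 0 \<longrightarrow>
      T x < \<infinity> \<and> enn2real (T x) powr p \<le> (C * v x) powr (p - 1) * enn2real (S x) \<and> S x < \<infinity>"
    using vpos row AE_space
  proof eventually_elim
    case (elim x)
    show ?case
    proof
      assume "h x \<noteq> 0"
      then have "0 < m x" using elim nonneg(2)[of x] by (simp add: m_def order_less_le)
      then have "S x < \<infinity>" using elim by (auto simp: ennreal_mult_eq_top_iff less_top)
      then show "T x < \<infinity> \<and> enn2real (T x) powr p \<le> (C * v x) powr (p - 1) * enn2real (S x) \<and> S x < \<infinity>"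
        using pointwise[of x] elim by auto
    qed
  qed
  then show "AE x in M. h x \<noteq> 0 \<longrightarrow> (\<integral>\<^sup>+y. ennreal (k x y * \<bar>f y\<bar>) \<partial>M') < \<infinity>"
    by eventually_elim (auto simp: T_def)

  have "(\<integral>\<^sup>+x. ennreal (h x * enn2real (T x) powr p) \<partial>M) \<le> (\<integral>\<^sup>+x. ennreal (C powr (p - 1)) * (ennreal (m x) * S x) \<partial>M)"
  proof (intro nn_integral_mono_AE)
    show "AE x in M. ennreal (h x * enn2real (T x) powr p) \<le> ennreal (C powr (p - 1)) * (ennreal (m x) * S x)"
      using AE vpos
    proof eventually_elim
      case (elim x)
      show ?case
      proof (cases "h x = 0")
        case False
        have "h x * enn2real (T x) powr p \<le> h x * ((C * v x) powr (p - 1) * enn2real (S x))"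
          using elim False nonneg by (intro mult_left_mono) auto
        also have "\<dots> = C powr (p - 1) * (m x * enn2real (S x))"
          using CD elim by (simp add: m_def powr_mult)
        finally have "ennreal (h x * enn2real (T x) powr p) \<le> ennreal (C powr (p - 1) * (m x * enn2real (S x)))"
          by (rule ennreal_leI)
        then show ?thesis using elim False Fm by (simp add: ennreal_mult)
      qed simp
    qed
  qed
  also have "\<dots> = ennreal (C powr (p - 1)) * (\<integral>\<^sup>+x. ennreal (m x) * S x \<partial>M)" by (rule nn_integral_cmult) measurable
  also have "\<dots> \<le> ennreal (C powr (p - 1)) * (ennreal D * (\<integral>\<^sup>+y. ennreal (\<bar>f y\<bar> powr p) \<partial>M'))"
    by (intro mult_left_mono total) auto
  finally show "(\<integral>\<^sup>+x. ennreal (h x * enn2real (\<integral>\<^sup>+y. ennreal (k x y * \<bar>f y\<bar>) \<partial>M') powr p) \<partial>M)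
      \<le> ennreal (C powr (p - 1) * D) * (\<integral>\<^sup>+y. ennreal (\<bar>f y\<bar> powr p) \<partial>M')"
    using CD by (simp add: T_def ennreal_mult mult.assoc)
qed

section \<open>Lebesgue measure: products and powers of the radius\<close>

text \<open>
  Tonelli's theorem is applied to products of the completed measure itself; the kernels are Borel
  functions of the coordinates, so it suffices that the coordinate maps are measurable into the
  Borel sets.
\<close>

lemma measurable_lebesgue_borel [measurable]:
  "(\<lambda>x::'a::euclidean_space. x) \<in> lebesgue \<rightarrow>\<^sub>M borel"
  "fst \<in> (lebesgue :: 'a measure) \<Otimes>\<^sub>M M \<rightarrow>\<^sub>M borel"
  "snd \<in> M \<Otimes>\<^sub>M (lebesgue :: 'a measure) \<rightarrow>\<^sub>M borel"
proof -
  show id: "(\<lambda>x::'a. x) \<in> lebesgue \<rightarrow>\<^sub>M borel"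
    by (simp add: measurable_completion)
  show "fst \<in> (lebesgue :: 'a measure) \<Otimes>\<^sub>M M \<rightarrow>\<^sub>M borel"
    by (rule measurable_compose[OF measurable_fst id])
  show "snd \<in> M \<Otimes>\<^sub>M (lebesgue :: 'a measure) \<rightarrow>\<^sub>M borel"
    by (rule measurable_compose[OF measurable_snd id])
qed

lemma ball_lebesgue_measurable [measurable]: "ball (x::'a::euclidean_space) r \<in> sets lebesgue"
  by simp

lemma sigma_finite_lebesgue: "sigma_finite_measure (lebesgue :: 'a::euclidean_space measure)"
proof
  obtain A :: "'a set set" where "countable A" "A \<subseteq> sets lborel" "\<Union> A = space lborel"
    "\<forall>a\<in>A. emeasure lborel a \<noteq> \<infinity>"
    using lborel.sigma_finite_countable by blast
  then show "\<exists>A::'a set set. countable A \<and> A \<subseteq> sets lebesgue \<and> \<Union> A = space lebesgue \<and>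
      (\<forall>a\<in>A. emeasure lebesgue a \<noteq> \<infinity>)"
    by (intro exI[of _ A]) (auto simp: sets_completionI_sets subset_eq)
qed

interpretation lebesgue: sigma_finite_measure "lebesgue :: 'a::euclidean_space measure"
  by (rule sigma_finite_lebesgue)

interpretation lebesgue_pair: pair_sigma_finite
  "lebesgue :: 'a::euclidean_space measure" "lebesgue :: 'b::euclidean_space measure" ..

interpretation lebesgue_lborel: pair_sigma_finite
  "lebesgue :: 'a::euclidean_space measure" "lborel :: 'b::euclidean_space measure" ..

lemma indicator_ball_measurable [measurable]:
  "(\<lambda>z. indicator (ball x (snd z)) (fst z) :: ennreal)
     \<in> borel_measurable ((lebesgue :: 'a::euclidean_space measure) \<Otimes>\<^sub>M lborel)"
proof -
  have "Measurable.pred ((lebesgue :: 'a measure) \<Otimes>\<^sub>M lborel) (\<lambda>z. dist x (fst z) < snd z)"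
    by measurable
  then show ?thesis
    unfolding indicator_def mem_ball by measurable
qed

lemma emeasure_ball_powr:
  fixes x :: "'a::euclidean_space"
  assumes "0 \<le> r"
  shows "emeasure lborel (ball x r) = ennreal (unit_ball_vol (real DIM('a)) * r powr real DIM('a))"
  using assms emeasure_ball[of r x] by (cases "r = 0") (auto simp: powr_realpow)

lemma nn_integral_powr_tail:
  fixes m s :: real
  assumes "0 < m" "0 < s"
  shows "(\<integral>\<^sup>+\<sigma>. ennreal (\<sigma> powr (-s - 1)) * indicator {m<..} \<sigma> \<partial>lborel) = ennreal (m powr (-s) / s)"
proof -
  have "((\<lambda>\<sigma>. \<sigma> powr (-s - 1)) has_integral m powr (-s) / s) {m..}"
    using has_integral_powr_to_inf[of "-s-1" m] assms by simp
  then have "(\<integral>\<^sup>+\<sigma>. ennreal (\<sigma> powr (-s - 1)) * indicator {m..} \<sigma> \<partial>lborel) = ennreal (m powr (-s) / s)"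
    by (intro nn_integral_has_integral_lebesgue') auto
  moreover have "(\<integral>\<^sup>+\<sigma>. ennreal (\<sigma> powr (-s - 1)) * indicator {m..} \<sigma> \<partial>lborel)
      = (\<integral>\<^sup>+\<sigma>. ennreal (\<sigma> powr (-s - 1)) * indicator {m<..} \<sigma> \<partial>lborel)"
    using AE_lborel_singleton[of m]
    by (intro nn_integral_cong_AE) (auto elim!: eventually_mono simp: indicator_def)
  ultimately show ?thesis by simp
qed

lemma nn_integral_powr_head:
  fixes m s :: real
  assumes "0 \<le> m" "0 < s"
  shows "(\<integral>\<^sup>+\<sigma>. ennreal (\<sigma> powr (s - 1)) * indicator {0..m} \<sigma> \<partial>lborel) = ennreal (m powr s / s)"
  using has_integral_powr_from_0[of "s-1" m] assms
  by (intro nn_integral_has_integral_lebesgue') auto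

text \<open>
  A power kernel is a superposition of indicators of balls:
  \<open>m powr (-s)\<close> is the integral of \<open>s * \<sigma> powr (-s - 1)\<close> over \<open>\<sigma> > m\<close>. Truncating the kernel at distance
  \<open>\<rho>\<close> truncates the range of radii. Only an inequality holds in general, because the kernel has the
  value \<open>0\<close> at \<open>m = 0\<close>.
\<close>

lemma layer_cake:
  fixes g :: "'a::euclidean_space \<Rightarrow> ennreal" and x :: 'a
  assumes [measurable]: "g \<in> borel_measurable lebesgue" and s: "0 < s" and \<rho>: "0 \<le> \<rho>"
  shows "(\<integral>\<^sup>+z. ennreal (max (norm (x - z)) \<rho> powr (-s)) * g z \<partial>lebesgue)
    \<le> (\<integral>\<^sup>+\<sigma>. ennreal (s * \<sigma> powr (-s - 1)) * indicator {\<rho><..} \<sigma> *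
          (\<integral>\<^sup>+z\<in>ball x \<sigma>. g z \<partial>lebesgue) \<partial>lborel)"
proof -
  have kernel: "ennreal (m powr (-s)) \<le> (\<integral>\<^sup>+\<sigma>. ennreal (s * \<sigma> powr (-s - 1)) * indicator {m<..} \<sigma> \<partial>lborel)"
    if "0 \<le> m" for m :: real
  proof (cases "m = 0")
    case False
    have "(\<integral>\<^sup>+\<sigma>. ennreal (s * \<sigma> powr (-s - 1)) * indicator {m<..} \<sigma> \<partial>lborel)
        = ennreal s * (\<integral>\<^sup>+\<sigma>. ennreal (\<sigma> powr (-s - 1)) * indicator {m<..} \<sigma> \<partial>lborel)"
      using s by (subst nn_integral_cmult[symmetric]) (auto simp: ennreal_mult' ac_simps)
    also have "\<dots> = ennreal (m powr (-s))"
      using s that False by (simp add: nn_integral_powr_tail ennreal_mult'[symmetric])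
    finally show ?thesis by simp
  qed auto
  have "(\<integral>\<^sup>+z. ennreal (max (norm (x - z)) \<rho> powr (-s)) * g z \<partial>lebesgue)
      \<le> (\<integral>\<^sup>+z. (\<integral>\<^sup>+\<sigma>. ennreal (s * \<sigma> powr (-s - 1)) * indicator {max (norm (x - z)) \<rho><..} \<sigma> \<partial>lborel) * g z \<partial>lebesgue)"
    using \<rho> by (intro nn_integral_mono mult_right_mono kernel) auto
  also have "\<dots> = (\<integral>\<^sup>+z. (\<integral>\<^sup>+\<sigma>. ennreal (s * \<sigma> powr (-s - 1)) * indicator {\<rho><..} \<sigma> *
        (g z * indicator (ball x \<sigma>) z) \<partial>lborel) \<partial>lebesgue)"
    by (subst nn_integral_multc[symmetric])
       (auto intro!: nn_integral_cong simp: indicator_def dist_norm)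
  also have "\<dots> = (\<integral>\<^sup>+\<sigma>. (\<integral>\<^sup>+z. ennreal (s * \<sigma> powr (-s - 1)) * indicator {\<rho><..} \<sigma> *
        (g z * indicator (ball x \<sigma>) z) \<partial>lebesgue) \<partial>lborel)"
    by (intro lebesgue_lborel.Fubini'[symmetric]) (unfold split_beta', measurable)
  also have "\<dots> = (\<integral>\<^sup>+\<sigma>. ennreal (s * \<sigma> powr (-s - 1)) * indicator {\<rho><..} \<sigma> *
          (\<integral>\<^sup>+z\<in>ball x \<sigma>. g z \<partial>lebesgue) \<partial>lborel)"
    by (intro nn_integral_cong nn_integral_cmult) measurable
  finally show ?thesis .
qed

section \<open>Riesz kernels and masses of balls\<close>

definition hedberg_const :: "real \<Rightarrow> real \<Rightarrow> real \<Rightarrow> real \<Rightarrow> real" where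
  "hedberg_const d \<alpha> a a' = (d - \<alpha>) * (1 / (\<alpha> - a) + 1 / (a' - \<alpha>))"

text \<open>
  In the layer-cake formula use the bound \<open>small\<close> for radii up to \<open>R\<close> and the bound \<open>large\<close> beyond
  \<open>R\<close>. The conditions \<open>a < \<alpha> < a'\<close> make both power integrals converge.
\<close>

lemma hedberg_interpolation:
  fixes g :: "'a::euclidean_space \<Rightarrow> ennreal" and x :: 'a
  defines "d \<equiv> real DIM('a)"
  assumes g[measurable]: "g \<in> borel_measurable lebesgue"
    and \<alpha>: "\<alpha> < d" "a < \<alpha>" "\<alpha> < a'" and N: "0 \<le> N" and E: "0 < E"
    and small: "\<And>\<sigma>. 0 < \<sigma> \<Longrightarrow> (\<integral>\<^sup>+z\<in>ball x \<sigma>. g z \<partial>lebesgue) \<le> ennreal (N * E * \<sigma> powr (d - a))"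
    and large: "\<And>\<sigma>. 0 < \<sigma> \<Longrightarrow> (\<integral>\<^sup>+z\<in>ball x \<sigma>. g z \<partial>lebesgue) \<le> ennreal (N * \<sigma> powr (d - a'))"
  shows "(\<integral>\<^sup>+z. ennreal (norm (x - z) powr (\<alpha> - d)) * g z \<partial>lebesgue)
    \<le> ennreal (hedberg_const d \<alpha> a a' * N * E powr ((a' - \<alpha>) / (a' - a)))"
proof -
  \<comment> \<open>The radius at which the two bounds on the mass coincide.\<close>
  define R where "R = E powr (- 1 / (a' - a))"
  have R: "0 < R" using E by (simp add: R_def)
  define t where "t = (a' - \<alpha>) / (a' - a)"
  have "- 1 / (a' - a) * (\<alpha> - a') = t" and e: "- 1 / (a' - a) * (\<alpha> - a) + 1 = t"
    using \<alpha> by (simp_all add: t_def field_simps)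
  then have R_large: "R powr (\<alpha> - a') = E powr t"
    by (simp only: R_def powr_powr)
  have "E * R powr (\<alpha> - a) = E powr (- 1 / (a' - a) * (\<alpha> - a) + 1)"
    unfolding R_def powr_powr powr_add using E by simp
  then have R_small: "E * R powr (\<alpha> - a) = E powr t"
    by (simp only: e)
  let ?I = "\<lambda>\<sigma>. ennreal ((d - \<alpha>) * \<sigma> powr (-(d - \<alpha>) - 1)) * indicator {0<..} \<sigma> *
          (\<integral>\<^sup>+z\<in>ball x \<sigma>. g z \<partial>lebesgue)"
  have pointwise: "?I \<sigma> \<le> ennreal ((d - \<alpha>) * N * E) * (ennreal (\<sigma> powr (\<alpha> - a - 1)) * indicator {0..R} \<sigma>)
      + ennreal ((d - \<alpha>) * N) * (ennreal (\<sigma> powr (-(a' - \<alpha>) - 1)) * indicator {R<..} \<sigma>)" for \<sigma>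
  proof (cases "0 < \<sigma>")
    case True
    consider "\<sigma> \<le> R" | "R < \<sigma>" by linarith
    then show ?thesis
    proof cases
      case 1
      have "?I \<sigma> \<le> ennreal ((d - \<alpha>) * \<sigma> powr (-(d - \<alpha>) - 1)) * ennreal (N * E * \<sigma> powr (d - a))"
        using True small[OF True] by (simp add: mult_left_mono)
      also have "\<dots> = ennreal ((d - \<alpha>) * N * E * (\<sigma> powr (-(d - \<alpha>) - 1) * \<sigma> powr (d - a)))"
        using \<alpha> N E by (subst ennreal_mult[symmetric]) (auto simp: ac_simps)
      also have "\<sigma> powr (-(d - \<alpha>) - 1) * \<sigma> powr (d - a) = \<sigma> powr (\<alpha> - a - 1)"
        by (simp add: powr_add[symmetric] algebra_simps)
      finally show ?thesis
        using 1 True \<alpha> N E by (simp add: ennreal_mult)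
    next
      case 2
      have "?I \<sigma> \<le> ennreal ((d - \<alpha>) * \<sigma> powr (-(d - \<alpha>) - 1)) * ennreal (N * \<sigma> powr (d - a'))"
        using True large[OF True] by (simp add: mult_left_mono)
      also have "\<dots> = ennreal ((d - \<alpha>) * N * (\<sigma> powr (-(d - \<alpha>) - 1) * \<sigma> powr (d - a')))"
        using \<alpha> N by (subst ennreal_mult[symmetric]) (auto simp: ac_simps)
      also have "\<sigma> powr (-(d - \<alpha>) - 1) * \<sigma> powr (d - a') = \<sigma> powr (-(a' - \<alpha>) - 1)"
        by (simp add: powr_add[symmetric] algebra_simps)
      finally show ?thesis
        using 2 True \<alpha> N by (simp add: ennreal_mult)
    qed
  qed simp
  have "(\<integral>\<^sup>+z. ennreal (norm (x - z) powr (\<alpha> - d)) * g z \<partial>lebesgue) \<le> (\<integral>\<^sup>+\<sigma>. ?I \<sigma> \<partial>lborel)"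
    using layer_cake[OF g, of "d - \<alpha>" 0 x] \<alpha> by simp
  also have "\<dots> \<le> (\<integral>\<^sup>+\<sigma>. ennreal ((d - \<alpha>) * N * E) * (ennreal (\<sigma> powr (\<alpha> - a - 1)) * indicator {0..R} \<sigma>)
      + ennreal ((d - \<alpha>) * N) * (ennreal (\<sigma> powr (-(a' - \<alpha>) - 1)) * indicator {R<..} \<sigma>) \<partial>lborel)"
    by (intro nn_integral_mono pointwise)
  also have "\<dots> = ennreal ((d - \<alpha>) * N * E) * ennreal (R powr (\<alpha> - a) / (\<alpha> - a))
      + ennreal ((d - \<alpha>) * N) * ennreal (R powr (- (a' - \<alpha>)) / (a' - \<alpha>))"
    using \<alpha> R nn_integral_powr_head[of R "\<alpha> - a"] nn_integral_powr_tail[of R "a' - \<alpha>"]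
    by (simp add: nn_integral_add nn_integral_cmult)
  also have "\<dots> = ennreal ((d - \<alpha>) * N * ((E * R powr (\<alpha> - a)) / (\<alpha> - a) + R powr (\<alpha> - a') / (a' - \<alpha>)))"
  proof -
    have "ennreal u * ennreal v + ennreal u' * ennreal v' = ennreal (u * v + u' * v')"
      if "0 \<le> u" "0 \<le> v" "0 \<le> u'" "0 \<le> v'" for u v u' v'
      using that by (simp add: ennreal_mult)
    then show ?thesis
      using \<alpha> N E by (simp add: distrib_left mult.assoc)
  qed
  also have "\<dots> = ennreal (hedberg_const d \<alpha> a a' * N * E powr t)"
    unfolding R_small R_large hedberg_const_def by (simp add: field_simps)
  finally show ?thesis by (simp add: t_def)
qed

text \<open>
  The first summand serves centres far from the singularity, the second centres close to it.
\<close>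

definition kernel_mean_const :: "real \<Rightarrow> real \<Rightarrow> real" where
  "kernel_mean_const d \<gamma> = unit_ball_vol d * (2 powr (d - \<gamma>) + hedberg_const d \<gamma> 0 d * 3 powr \<gamma> * 2 powr (d - \<gamma>))"

text \<open>
  Hedberg's interpolation applies to the indicator of the ball: its mass in a ball of radius \<open>\<sigma>\<close> is
  at most the volume of either ball, which are the cases \<open>a = 0\<close> and \<open>a' = d\<close>.
\<close>

lemma nn_integral_ball_kernel_centered:
  fixes z :: "'a::euclidean_space"
  defines "d \<equiv> real DIM('a)"
  assumes \<gamma>: "0 < \<gamma>" "\<gamma> < d" and r: "0 < r"
  shows "(\<integral>\<^sup>+y\<in>ball z r. ennreal (norm (z - y) powr (\<gamma> - d)) \<partial>lebesgue)
    \<le> ennreal (hedberg_const d \<gamma> 0 d * unit_ball_vol d * r powr \<gamma>)"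
proof -
  let ?V = "unit_ball_vol d"
  have V: "0 \<le> ?V" by (simp add: d_def)
  have d: "0 < d" by (simp add: d_def)
  have "(\<integral>\<^sup>+y. ennreal (norm (z - y) powr (\<gamma> - d)) * indicator (ball z r) y \<partial>lebesgue)
    \<le> ennreal (hedberg_const d \<gamma> 0 d * (?V * r powr d) * (r powr (-d)) powr ((d - \<gamma>) / (d - 0)))"
    unfolding d_def
  proof (rule hedberg_interpolation; (fold d_def)?)
    show "(\<integral>\<^sup>+ y\<in>ball z \<sigma>. indicator (ball z r) y \<partial>lebesgue) \<le> ennreal (?V * r powr d * r powr -d * \<sigma> powr (d - 0))"
      if "0 < \<sigma>" for \<sigma>
    proof -
      have "(\<integral>\<^sup>+ y\<in>ball z \<sigma>. indicator (ball z r) y \<partial>lebesgue) \<le> (\<integral>\<^sup>+ y. indicator (ball z \<sigma>) y \<partial>lebesgue)"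
        by (intro nn_integral_mono) (auto simp: indicator_def)
      also have "\<dots> = ennreal (?V * \<sigma> powr d)"
        using that by (simp add: emeasure_ball_powr d_def)
      finally show ?thesis using r by (simp add: powr_minus field_simps)
    qed
    show "(\<integral>\<^sup>+ y\<in>ball z \<sigma>. indicator (ball z r) y \<partial>lebesgue) \<le> ennreal (?V * r powr d * \<sigma> powr (d - d))"
      if "0 < \<sigma>" for \<sigma>
    proof -
      have "(\<integral>\<^sup>+ y\<in>ball z \<sigma>. indicator (ball z r) y \<partial>lebesgue) \<le> (\<integral>\<^sup>+ y. indicator (ball z r) y \<partial>lebesgue)"
        by (intro nn_integral_mono) (auto simp: indicator_def)
      also have "\<dots> = ennreal (?V * r powr d)"
        using r by (simp add: emeasure_ball_powr d_def)
      finally show ?thesis using that by simp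
    qed
  qed (use \<gamma> r V d in \<open>auto\<close>)
  also have "r powr d * (r powr (-d)) powr ((d - \<gamma>) / (d - 0)) = r powr \<gamma>"
    using d by (simp add: powr_powr powr_add[symmetric])
  then have "hedberg_const d \<gamma> 0 d * (?V * r powr d) * (r powr (-d)) powr ((d - \<gamma>) / (d - 0))
      = hedberg_const d \<gamma> 0 d * ?V * r powr \<gamma>"
    by (metis mult.assoc)
  finally show ?thesis by simp
qed

text \<open>
  If the singularity \<open>z\<close> is further than \<open>2\<rho>\<close> from the centre, the kernel is comparable to a constant on
  the ball. Otherwise the ball lies in the ball of radius \<open>3\<rho>\<close> around \<open>z\<close>, where the kernel
  integral is known.
\<close>

lemma nn_integral_ball_kernel:
  fixes x z :: "'a::euclidean_space"
  defines "d \<equiv> real DIM('a)"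
  assumes \<gamma>: "0 < \<gamma>" "\<gamma> < d" and \<rho>: "0 < \<rho>"
  shows "(\<integral>\<^sup>+y\<in>ball x \<rho>. ennreal (norm (y - z) powr (\<gamma> - d)) \<partial>lebesgue)
    \<le> ennreal (kernel_mean_const d \<gamma> * \<rho> powr d * max (norm (x - z)) \<rho> powr (\<gamma> - d))"
proof -
  let ?V = "unit_ball_vol d" and ?m = "max (norm (x - z)) \<rho>"
  have V: "0 \<le> ?V" by (simp add: d_def)
  have d: "0 < d" by (simp add: d_def)
  have two: "2 powr (d - \<gamma>) = 1 / 2 powr (\<gamma> - d)" using powr_minus_divide[of 2 "\<gamma> - d"] by simp
  have H: "0 \<le> hedberg_const d \<gamma> 0 d" using \<gamma> by (simp add: hedberg_const_def)
  show ?thesis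
  proof (cases "2 * \<rho> \<le> norm (x - z)")
    case True
    have "(\<integral>\<^sup>+y\<in>ball x \<rho>. ennreal (norm (y - z) powr (\<gamma> - d)) \<partial>lebesgue)
        \<le> (\<integral>\<^sup>+y. ennreal ((?m / 2) powr (\<gamma> - d)) * indicator (ball x \<rho>) y \<partial>lebesgue)"
    proof (intro nn_integral_mono)
      fix y
      have "?m / 2 \<le> norm (y - z)" if "y \<in> ball x \<rho>"
        using that True \<rho> norm_triangle_ineq[of "x - y" "y - z"] by (simp add: dist_norm)
      then have "norm (y - z) powr (\<gamma> - d) \<le> (?m / 2) powr (\<gamma> - d)" if "y \<in> ball x \<rho>"
        using that \<gamma> \<rho> by (intro powr_mono2') auto
      then show "ennreal (norm (y - z) powr (\<gamma> - d)) * indicator (ball x \<rho>) y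
          \<le> ennreal ((?m / 2) powr (\<gamma> - d)) * indicator (ball x \<rho>) y"
        by (auto simp: indicator_def intro!: ennreal_leI)
    qed
    also have "\<dots> = ennreal ((?m / 2) powr (\<gamma> - d) * (?V * \<rho> powr d))"
      using \<rho> by (simp add: nn_integral_cmult emeasure_ball_powr d_def ennreal_mult')
    also have "(?m / 2) powr (\<gamma> - d) = ?m powr (\<gamma> - d) * 2 powr (d - \<gamma>)"
      using \<rho> by (simp add: powr_divide two)
    also have "?m powr (\<gamma> - d) * 2 powr (d - \<gamma>) * (?V * \<rho> powr d)
        \<le> kernel_mean_const d \<gamma> * \<rho> powr d * ?m powr (\<gamma> - d)"
      using V H by (simp add: kernel_mean_const_def algebra_simps)
    finally show ?thesis by (simp add: ennreal_leI)
  next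
    case False
    have "(\<integral>\<^sup>+y\<in>ball x \<rho>. ennreal (norm (y - z) powr (\<gamma> - d)) \<partial>lebesgue)
        \<le> (\<integral>\<^sup>+y\<in>ball z (3 * \<rho>). ennreal (norm (z - y) powr (\<gamma> - d)) \<partial>lebesgue)"
    proof (intro nn_integral_mono)
      fix y
      have "y \<in> ball z (3 * \<rho>)" if "y \<in> ball x \<rho>"
        using that False dist_triangle[of z y x] by (simp add: dist_norm norm_minus_commute)
      then show "ennreal (norm (y - z) powr (\<gamma> - d)) * indicator (ball x \<rho>) y
          \<le> ennreal (norm (z - y) powr (\<gamma> - d)) * indicator (ball z (3 * \<rho>)) y"
        by (auto simp: indicator_def norm_minus_commute)
    qed
    also have "\<dots> \<le> ennreal (hedberg_const d \<gamma> 0 d * ?V * (3 * \<rho>) powr \<gamma>)"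
      unfolding d_def using \<gamma> \<rho> by (intro nn_integral_ball_kernel_centered) (auto simp: d_def)
    also have "hedberg_const d \<gamma> 0 d * ?V * (3 * \<rho>) powr \<gamma>
        = hedberg_const d \<gamma> 0 d * ?V * 3 powr \<gamma> * \<rho> powr d * \<rho> powr (\<gamma> - d)"
      using \<rho> by (simp add: powr_mult powr_diff)
    also have "\<dots> \<le> hedberg_const d \<gamma> 0 d * ?V * 3 powr \<gamma> * \<rho> powr d * (2 powr (d - \<gamma>) * ?m powr (\<gamma> - d))"
    proof -
      have "(2 * \<rho>) powr (\<gamma> - d) \<le> ?m powr (\<gamma> - d)"
        using False \<rho> \<gamma> by (intro powr_mono2') auto
      then have "\<rho> powr (\<gamma> - d) \<le> 2 powr (d - \<gamma>) * ?m powr (\<gamma> - d)"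
        using \<rho> by (simp add: powr_mult two field_simps)
      then show ?thesis using H V by (intro mult_left_mono) auto
    qed
    also have "\<dots> \<le> kernel_mean_const d \<gamma> * \<rho> powr d * ?m powr (\<gamma> - d)"
      using V H by (simp add: kernel_mean_const_def algebra_simps)
    finally show ?thesis by (simp add: ennreal_leI)
  qed
qed

section \<open>The potential of a Morrey density as a weight\<close>

definition mean_const :: "real \<Rightarrow> real \<Rightarrow> real \<Rightarrow> real \<Rightarrow> real" where
  "mean_const d \<alpha> q \<gamma> = kernel_mean_const d \<gamma> * max 1 ((d - \<gamma>) / (\<alpha> * q - \<gamma>))"

definition potential_const :: "real \<Rightarrow> real \<Rightarrow> real \<Rightarrow> real \<Rightarrow> real \<Rightarrow> real \<Rightarrow> real" where
  "potential_const d \<alpha> q \<gamma> s t =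
     hedberg_const d \<alpha> (\<gamma> * s) (\<alpha> * q * s + (\<alpha> * q - \<gamma>) * t) *
     (mean_const d \<alpha> q \<gamma> powr t * unit_ball_vol d powr (1 - s - t))"

text \<open>
  The density \<open>\<beta>\<close> is \<open>\<bar>b\<bar> powr q\<close>, scaled so that the Morrey bound has constant \<open>1\<close>; hence all
  constants below depend on the exponents and the dimension only. The dimension is a parameter
  because an abbreviation for it would carry the type of the points as an extra argument.
\<close>

locale morrey_density =
  fixes \<beta> :: "'a::euclidean_space \<Rightarrow> real" and d \<alpha> q \<gamma> :: real
  assumes dimension: "d = real DIM('a)"
    and measurable_density [measurable]: "\<beta> \<in> borel_measurable lebesgue"
    and density_nonneg: "0 \<le> \<beta> x"
    and exponents: "0 < \<gamma>" "\<gamma> < \<alpha>" "\<alpha> < d" "\<gamma> < \<alpha> * q"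
    and density_ball: "0 < \<rho> \<Longrightarrow>
      (\<integral>\<^sup>+z\<in>ball x \<rho>. ennreal (\<beta> z) \<partial>lebesgue) \<le> ennreal (\<rho> powr (d - \<alpha> * q))"
begin

definition potential :: "'a \<Rightarrow> ennreal" where
  "potential x = (\<integral>\<^sup>+z. ennreal (norm (x - z) powr (\<gamma> - d)) * ennreal (\<beta> z) \<partial>lebesgue)"

definition weight :: "'a \<Rightarrow> real" where
  "weight x = enn2real (potential x)"

lemma measurable_potential [measurable]: "potential \<in> borel_measurable lebesgue"
  unfolding potential_def by measurable

lemma measurable_weight [measurable]: "weight \<in> borel_measurable lebesgue"
  unfolding weight_def by measurable

lemma weight_nonneg: "0 \<le> weight x"
  by (simp add: weight_def)

lemma kernel_mean_const_pos: "0 < kernel_mean_const d \<gamma>"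
proof -
  have "0 < hedberg_const d \<gamma> 0 d" using exponents by (auto simp: hedberg_const_def intro!: mult_pos_pos add_pos_pos)
  moreover have "0 < unit_ball_vol d" by (simp add: dimension)
  ultimately show ?thesis
    unfolding kernel_mean_const_def by (intro mult_pos_pos add_pos_pos) auto
qed

lemma mean_const_pos: "0 < mean_const d \<alpha> q \<gamma>"
  using kernel_mean_const_pos by (simp add: mean_const_def)

text \<open>
  Averaging the potential over a ball of radius \<open>\<rho>\<close> truncates its kernel at distance \<open>\<rho>\<close>.
\<close>

lemma potential_mean:
  assumes \<rho>: "0 < \<rho>"
  shows "(\<integral>\<^sup>+y\<in>ball x \<rho>. potential y \<partial>lebesgue) \<le> ennreal (kernel_mean_const d \<gamma> * \<rho> powr d) *
     (\<integral>\<^sup>+z. ennreal (max (norm (x - z)) \<rho> powr (\<gamma> - d)) * ennreal (\<beta> z) \<partial>lebesgue)"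
proof -
  have [measurable]: "(\<lambda>z. indicator (ball x \<rho>) (fst z) :: ennreal) \<in> borel_measurable (lebesgue \<Otimes>\<^sub>M lebesgue)"
    "(\<lambda>z. indicator (ball x \<rho>) (snd z) :: ennreal) \<in> borel_measurable (lebesgue \<Otimes>\<^sub>M lebesgue)"
    by measurable
  have "(\<integral>\<^sup>+y\<in>ball x \<rho>. potential y \<partial>lebesgue)
      = (\<integral>\<^sup>+y. (\<integral>\<^sup>+z. ennreal (norm (y - z) powr (\<gamma> - d)) * ennreal (\<beta> z) * indicator (ball x \<rho>) y \<partial>lebesgue) \<partial>lebesgue)"
    unfolding potential_def by (intro nn_integral_cong nn_integral_multc[symmetric]) measurable
  also have "\<dots> = (\<integral>\<^sup>+z. (\<integral>\<^sup>+y. ennreal (norm (y - z) powr (\<gamma> - d)) * ennreal (\<beta> z) * indicator (ball x \<rho>) y \<partial>lebesgue) \<partial>lebesgue)"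
    by (intro lebesgue_pair.Fubini') (unfold split_beta', measurable)
  also have "\<dots> = (\<integral>\<^sup>+z. (\<integral>\<^sup>+y\<in>ball x \<rho>. ennreal (norm (y - z) powr (\<gamma> - d)) \<partial>lebesgue) * ennreal (\<beta> z) \<partial>lebesgue)"
    by (intro nn_integral_cong, subst nn_integral_multc[symmetric]) (auto intro!: nn_integral_cong simp: ac_simps)
  also have "\<dots> \<le> (\<integral>\<^sup>+z. ennreal (kernel_mean_const d \<gamma> * \<rho> powr d * max (norm (x - z)) \<rho> powr (\<gamma> - d)) * ennreal (\<beta> z) \<partial>lebesgue)"
    using exponents \<rho> by (intro nn_integral_mono mult_right_mono nn_integral_ball_kernel[where 'a='a, folded dimension]) auto
  also have "\<dots> = ennreal (kernel_mean_const d \<gamma> * \<rho> powr d) *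
     (\<integral>\<^sup>+z. ennreal (max (norm (x - z)) \<rho> powr (\<gamma> - d)) * ennreal (\<beta> z) \<partial>lebesgue)"
    using kernel_mean_const_pos
    by (subst nn_integral_cmult[symmetric]) (auto intro!: nn_integral_cong simp: ennreal_mult mult.assoc)
  finally show ?thesis .
qed

text \<open>
  The \<open>A\<^sub>1\<close> condition: the truncated kernel lies below the kernel. The exception is the point \<open>x\<close>
  itself, where \<open>powr\<close> gives the kernel the value \<open>0\<close>.
\<close>

lemma potential_mean_le_self:
  assumes \<rho>: "0 < \<rho>"
  shows "(\<integral>\<^sup>+y\<in>ball x \<rho>. potential y \<partial>lebesgue) \<le> ennreal (mean_const d \<alpha> q \<gamma> * \<rho> powr d) * potential x"
proof -
  note potential_mean[OF \<rho>, of x]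
  also have "(\<integral>\<^sup>+z. ennreal (max (norm (x - z)) \<rho> powr (\<gamma> - d)) * ennreal (\<beta> z) \<partial>lebesgue) \<le> potential x"
    unfolding potential_def
  proof (intro nn_integral_mono_AE)
    have "AE z in lebesgue. z \<noteq> x"
      by (simp add: AE_completion AE_lborel_singleton)
    then show "AE z in lebesgue. ennreal (max (norm (x - z)) \<rho> powr (\<gamma> - d)) * ennreal (\<beta> z)
        \<le> ennreal (norm (x - z) powr (\<gamma> - d)) * ennreal (\<beta> z)"
      by eventually_elim (use exponents in \<open>auto intro!: mult_right_mono ennreal_leI powr_mono2'\<close>)
  qed
  also have "ennreal (kernel_mean_const d \<gamma> * \<rho> powr d) \<le> ennreal (mean_const d \<alpha> q \<gamma> * \<rho> powr d)"
    using kernel_mean_const_pos by (intro ennreal_leI mult_right_mono) (auto simp: mean_const_def)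
  finally show ?thesis by (simp add: mult_left_mono mult_right_mono)
qed

text \<open>
  By the layer-cake formula, the truncated potential only sees balls of radius above \<open>\<rho>\<close>, on which
  the Morrey bound is integrable because \<open>\<gamma> < \<alpha> q\<close>.
\<close>

lemma potential_mean_decay:
  assumes \<rho>: "0 < \<rho>"
  shows "(\<integral>\<^sup>+y\<in>ball x \<rho>. potential y \<partial>lebesgue) \<le> ennreal (mean_const d \<alpha> q \<gamma> * \<rho> powr (d - (\<alpha> * q - \<gamma>)))"
proof -
  define \<mu> where "\<mu> = \<alpha> * q - \<gamma>"
  have \<mu>: "0 < \<mu>" using exponents by (simp add: \<mu>_def)
  have "(\<integral>\<^sup>+z. ennreal (max (norm (x - z)) \<rho> powr (\<gamma> - d)) * ennreal (\<beta> z) \<partial>lebesgue)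
      \<le> (\<integral>\<^sup>+\<sigma>. ennreal ((d - \<gamma>) * \<sigma> powr (-(d - \<gamma>) - 1)) * indicator {\<rho><..} \<sigma> *
          (\<integral>\<^sup>+z\<in>ball x \<sigma>. ennreal (\<beta> z) \<partial>lebesgue) \<partial>lborel)"
    using layer_cake[of "\<lambda>z. ennreal (\<beta> z)" "d - \<gamma>" \<rho> x] exponents \<rho> by simp
  also have "\<dots> \<le> (\<integral>\<^sup>+\<sigma>. ennreal (d - \<gamma>) * (ennreal (\<sigma> powr (-\<mu> - 1)) * indicator {\<rho><..} \<sigma>) \<partial>lborel)"
  proof (intro nn_integral_mono)
    fix \<sigma> :: real
    show "ennreal ((d - \<gamma>) * \<sigma> powr (-(d - \<gamma>) - 1)) * indicator {\<rho><..} \<sigma> * (\<integral>\<^sup>+z\<in>ball x \<sigma>. ennreal (\<beta> z) \<partial>lebesgue)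
        \<le> ennreal (d - \<gamma>) * (ennreal (\<sigma> powr (-\<mu> - 1)) * indicator {\<rho><..} \<sigma>)"
    proof (cases "\<rho> < \<sigma>")
      case True
      then have "0 < \<sigma>" using \<rho> by simp
      have "ennreal ((d - \<gamma>) * \<sigma> powr (-(d - \<gamma>) - 1)) * (\<integral>\<^sup>+z\<in>ball x \<sigma>. ennreal (\<beta> z) \<partial>lebesgue)
          \<le> ennreal ((d - \<gamma>) * \<sigma> powr (-(d - \<gamma>) - 1)) * ennreal (\<sigma> powr (d - \<alpha> * q))"
        using \<open>0 < \<sigma>\<close> by (intro mult_left_mono density_ball) auto
      also have "\<dots> = ennreal ((d - \<gamma>) * (\<sigma> powr (-(d - \<gamma>) - 1) * \<sigma> powr (d - \<alpha> * q)))"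
        using exponents by (subst ennreal_mult[symmetric]) (auto simp: mult.assoc)
      also have "\<sigma> powr (-(d - \<gamma>) - 1) * \<sigma> powr (d - \<alpha> * q) = \<sigma> powr (-\<mu> - 1)"
        by (simp add: powr_add[symmetric] \<mu>_def algebra_simps)
      finally show ?thesis using True exponents by (simp add: ennreal_mult)
    qed simp
  qed
  also have "\<dots> = ennreal (d - \<gamma>) * ennreal (\<rho> powr (-\<mu>) / \<mu>)"
    using nn_integral_powr_tail[OF \<rho> \<mu>] by (simp add: nn_integral_cmult)
  also have "\<dots> = ennreal ((d - \<gamma>) / \<mu> * \<rho> powr (-\<mu>))"
    using exponents \<mu> by (simp add: ennreal_mult[symmetric])
  finally have "(\<integral>\<^sup>+y\<in>ball x \<rho>. potential y \<partial>lebesgue)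
      \<le> ennreal (kernel_mean_const d \<gamma> * \<rho> powr d) * ennreal ((d - \<gamma>) / \<mu> * \<rho> powr (-\<mu>))"
    by (intro order_trans[OF potential_mean[OF \<rho>]] mult_left_mono) auto
  also have "\<dots> = ennreal (kernel_mean_const d \<gamma> * ((d - \<gamma>) / \<mu>) * \<rho> powr (d - \<mu>))"
    using kernel_mean_const_pos exponents \<mu> \<rho>
    by (subst ennreal_mult[symmetric]) (auto simp: powr_diff powr_minus field_simps)
  also have "\<dots> \<le> ennreal (mean_const d \<alpha> q \<gamma> * \<rho> powr (d - \<mu>))"
    unfolding mean_const_def \<mu>_def[symmetric]
    using kernel_mean_const_pos by (intro ennreal_leI mult_right_mono mult_left_mono) auto
  finally show ?thesis by (simp add: \<mu>_def)
qed

lemma density_ball_le_potential: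
  assumes \<rho>: "0 < \<rho>"
  shows "(\<integral>\<^sup>+z\<in>ball x \<rho>. ennreal (\<beta> z) \<partial>lebesgue) \<le> ennreal (\<rho> powr (d - \<gamma>)) * potential x"
proof -
  have "(\<integral>\<^sup>+z\<in>ball x \<rho>. ennreal (\<beta> z) \<partial>lebesgue)
      \<le> (\<integral>\<^sup>+z. ennreal (\<rho> powr (d - \<gamma>)) * (ennreal (norm (x - z) powr (\<gamma> - d)) * ennreal (\<beta> z)) \<partial>lebesgue)"
  proof (intro nn_integral_mono_AE)
    have "AE z in lebesgue. z \<noteq> x"
      by (simp add: AE_completion AE_lborel_singleton)
    then show "AE z in lebesgue. ennreal (\<beta> z) * indicator (ball x \<rho>) z
        \<le> ennreal (\<rho> powr (d - \<gamma>)) * (ennreal (norm (x - z) powr (\<gamma> - d)) * ennreal (\<beta> z))"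
    proof eventually_elim
      case (elim z)
      show ?case
      proof (cases "z \<in> ball x \<rho>")
        case True
        have "1 = \<rho> powr (d - \<gamma>) * \<rho> powr (\<gamma> - d)" using \<rho> by (simp add: powr_add[symmetric])
        also have "\<dots> \<le> \<rho> powr (d - \<gamma>) * norm (x - z) powr (\<gamma> - d)"
          using True elim exponents by (intro mult_left_mono powr_mono2') (auto simp: dist_norm)
        finally have "1 * \<beta> z \<le> \<rho> powr (d - \<gamma>) * norm (x - z) powr (\<gamma> - d) * \<beta> z"
          by (rule mult_right_mono[OF _ density_nonneg])
        then show ?thesis
          using True density_nonneg[of z] by (simp add: ennreal_mult[symmetric] mult.assoc ennreal_leI)
      qed simp
    qed
  qed
  also have "\<dots> = ennreal (\<rho> powr (d - \<gamma>)) * potential x"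
    unfolding potential_def by (rule nn_integral_cmult) measurable
  finally show ?thesis .
qed

text \<open>
  The potential is integrable over every ball by the preceding decay estimate.
\<close>

lemma AE_potential_finite: "AE x in lebesgue. potential x < \<infinity>"
proof -
  have "AE x in lebesgue. x \<in> ball 0 (real (Suc n)) \<longrightarrow> potential x < \<infinity>" for n
  proof -
    have "(\<integral>\<^sup>+y. potential y * indicator (ball 0 (real (Suc n))) y \<partial>lebesgue) \<noteq> \<infinity>"
      using potential_mean_decay[of "real (Suc n)" 0] by (auto simp: top_unique)
    then have "AE x in lebesgue. potential x * indicator (ball 0 (real (Suc n))) x \<noteq> \<infinity>"
      by (intro nn_integral_PInf_AE) auto
    then show ?thesis
      by eventually_elim (auto simp: indicator_def less_top split: if_splits)
  qed
  then have "AE x in lebesgue. \<forall>n. x \<in> ball 0 (real (Suc n)) \<longrightarrow> potential x < \<infinity>"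
    unfolding AE_all_countable by blast
  then show ?thesis
  proof eventually_elim
    case (elim x)
    obtain n where "norm x < real (Suc n)"
      using reals_Archimedean2[of "norm x"] by (meson less_trans of_nat_less_iff lessI)
    then show ?case using elim by auto
  qed
qed

lemma potential_eq_weight: "potential x < \<infinity> \<Longrightarrow> potential x = ennreal (weight x)"
  by (simp add: weight_def less_top)

lemma weight_le_potential: "ennreal (weight x) \<le> potential x"
  by (cases "potential x = \<infinity>") (auto simp: weight_def less_top)

lemma density_zero_if_potential_zero:
  assumes "potential x = 0"
  shows "AE z in lebesgue. \<beta> z = 0"
proof -
  have "AE z in lebesgue. ennreal (norm (x - z) powr (\<gamma> - d)) * ennreal (\<beta> z) = 0"
    using assms unfolding potential_def by (subst (asm) nn_integral_0_iff_AE) auto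
  moreover have "AE z in lebesgue. z \<noteq> x"
    by (simp add: AE_completion AE_lborel_singleton)
  ultimately show ?thesis
    by eventually_elim (use density_nonneg in \<open>auto simp: ennreal_eq_0_iff order_antisym\<close>)
qed

text \<open>
  Hoelder's inequality on a ball, fed with the bounds by \<open>weight x\<close>, gives the estimate for small radii
  (\<open>a = \<gamma> s\<close>); fed with the decay bounds, it gives the one for large radii
  (\<open>a' = \<alpha> q s + \<mu> t\<close>). The final exponent is simple because \<open>a' - a = \<mu> (s + t)\<close>.
\<close>

lemma riesz_potential_monomial:
  assumes x: "potential x < \<infinity>" "0 < weight x"
    and st: "0 \<le> s" "0 < t" "s + t < 1" and \<alpha>: "\<gamma> * s < \<alpha>" "\<alpha> < \<alpha> * q * s + (\<alpha> * q - \<gamma>) * t"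
  shows "(\<integral>\<^sup>+z. ennreal (norm (x - z) powr (\<alpha> - d)) * ennreal (monomial_weight s t (\<beta> z) (weight z)) \<partial>lebesgue)
    \<le> ennreal (potential_const d \<alpha> q \<gamma> s t *
         weight x powr ((\<alpha> * q * s + (\<alpha> * q - \<gamma>) * t - \<alpha>) / (\<alpha> * q - \<gamma>)))"
proof -
  define \<mu> where "\<mu> = \<alpha> * q - \<gamma>"
  define w where "w = weight x"
  define C where "C = mean_const d \<alpha> q \<gamma>"
  define V where "V = unit_ball_vol d"
  define N where "N = C powr t * V powr (1 - s - t)"
  have \<mu>: "0 < \<mu>" and aq: "\<alpha> * q = \<mu> + \<gamma>" using exponents by (simp_all add: \<mu>_def)
  have pos: "0 < w" "0 < C" "0 < V" using x mean_const_pos by (simp_all add: w_def C_def V_def dimension)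
  have [measurable]: "(\<lambda>z. monomial_weight s t (\<beta> z) (weight z)) \<in> borel_measurable lebesgue"
    unfolding monomial_weight_def by measurable
  have vol: "emeasure lebesgue (ball x \<rho>) \<le> ennreal (V * \<rho> powr d)" if "0 < \<rho>" for \<rho>
    using that by (simp add: emeasure_ball_powr V_def dimension)
  have mean: "(\<integral>\<^sup>+y\<in>ball x \<rho>. ennreal (weight y) \<partial>lebesgue) \<le> (\<integral>\<^sup>+y\<in>ball x \<rho>. potential y \<partial>lebesgue)" for \<rho>
    by (intro nn_integral_mono mult_right_mono weight_le_potential) auto
  have "(\<integral>\<^sup>+z. ennreal (norm (x - z) powr (\<alpha> - d)) * ennreal (monomial_weight s t (\<beta> z) (weight z)) \<partial>lebesgue)
     \<le> ennreal (hedberg_const d \<alpha> (\<gamma> * s) (\<alpha> * q * s + \<mu> * t) * N *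
          (w powr (s + t)) powr ((\<alpha> * q * s + \<mu> * t - \<alpha>) / (\<alpha> * q * s + \<mu> * t - \<gamma> * s)))"
  proof (rule hedberg_interpolation[where 'a='a, folded dimension])
    fix \<rho> :: real assume \<rho>: "0 < \<rho>"
    have "(\<integral>\<^sup>+z\<in>ball x \<rho>. ennreal (monomial_weight s t (\<beta> z) (weight z)) \<partial>lebesgue)
      \<le> ennreal ((\<rho> powr (d - \<gamma>) * w) powr s * (C * \<rho> powr d * w) powr t * (V * \<rho> powr d) powr (1 - s - t))"
    proof (intro set_nn_integral_holder vol)
      show "(\<integral>\<^sup>+z\<in>ball x \<rho>. ennreal (\<beta> z) \<partial>lebesgue) \<le> ennreal (\<rho> powr (d - \<gamma>) * w)"
        using density_ball_le_potential[OF \<rho>, of x] x pos by (simp add: ennreal_mult w_def potential_eq_weight)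
      show "(\<integral>\<^sup>+z\<in>ball x \<rho>. ennreal (weight z) \<partial>lebesgue) \<le> ennreal (C * \<rho> powr d * w)"
        using order_trans[OF mean potential_mean_le_self[OF \<rho>, of x]] x pos
        by (simp add: ennreal_mult w_def potential_eq_weight C_def)
    qed (use st \<rho> pos density_nonneg weight_nonneg in auto)
    also have "(\<rho> powr (d - \<gamma>) * w) powr s * (C * \<rho> powr d * w) powr t * (V * \<rho> powr d) powr (1 - s - t)
        = N * (w powr s * w powr t) * (\<rho> powr ((d - \<gamma>) * s) * \<rho> powr (d * t) * \<rho> powr (d * (1 - s - t)))"
      using pos by (simp add: powr_mult powr_powr N_def)
    also have "\<rho> powr ((d - \<gamma>) * s) * \<rho> powr (d * t) * \<rho> powr (d * (1 - s - t)) = \<rho> powr (d - \<gamma> * s)"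
      by (simp add: powr_add[symmetric] algebra_simps)
    also have "w powr s * w powr t = w powr (s + t)" by (simp add: powr_add)
    finally show "(\<integral>\<^sup>+z\<in>ball x \<rho>. ennreal (monomial_weight s t (\<beta> z) (weight z)) \<partial>lebesgue)
      \<le> ennreal (N * w powr (s + t) * \<rho> powr (d - \<gamma> * s))" .
    have "(\<integral>\<^sup>+z\<in>ball x \<rho>. ennreal (monomial_weight s t (\<beta> z) (weight z)) \<partial>lebesgue)
      \<le> ennreal ((\<rho> powr (d - \<alpha> * q)) powr s * (C * \<rho> powr (d - \<mu>)) powr t * (V * \<rho> powr d) powr (1 - s - t))"
    proof (intro set_nn_integral_holder vol)
      show "(\<integral>\<^sup>+z\<in>ball x \<rho>. ennreal (\<beta> z) \<partial>lebesgue) \<le> ennreal (\<rho> powr (d - \<alpha> * q))"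
        using density_ball[OF \<rho>] .
      show "(\<integral>\<^sup>+z\<in>ball x \<rho>. ennreal (weight z) \<partial>lebesgue) \<le> ennreal (C * \<rho> powr (d - \<mu>))"
        using order_trans[OF mean potential_mean_decay[OF \<rho>, of x]] by (simp add: C_def \<mu>_def)
    qed (use st \<rho> pos density_nonneg weight_nonneg in auto)
    also have "(\<rho> powr (d - \<alpha> * q)) powr s * (C * \<rho> powr (d - \<mu>)) powr t * (V * \<rho> powr d) powr (1 - s - t)
        = N * (\<rho> powr ((d - \<alpha> * q) * s) * \<rho> powr ((d - \<mu>) * t) * \<rho> powr (d * (1 - s - t)))"
      using pos by (simp add: powr_mult powr_powr N_def)
    also have "\<rho> powr ((d - \<alpha> * q) * s) * \<rho> powr ((d - \<mu>) * t) * \<rho> powr (d * (1 - s - t)) = \<rho> powr (d - (\<alpha> * q * s + \<mu> * t))"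
      by (simp add: powr_add[symmetric] algebra_simps)
    finally show "(\<integral>\<^sup>+z\<in>ball x \<rho>. ennreal (monomial_weight s t (\<beta> z) (weight z)) \<partial>lebesgue)
      \<le> ennreal (N * \<rho> powr (d - (\<alpha> * q * s + \<mu> * t)))" .
  qed (use exponents \<alpha> pos in \<open>auto simp: N_def \<mu>_def\<close>)
  also have "(w powr (s + t)) powr ((\<alpha> * q * s + \<mu> * t - \<alpha>) / (\<alpha> * q * s + \<mu> * t - \<gamma> * s))
      = w powr ((\<alpha> * q * s + \<mu> * t - \<alpha>) / \<mu>)"
  proof -
    have "\<alpha> * q * s + \<mu> * t - \<gamma> * s = \<mu> * (s + t)" by (simp add: aq algebra_simps)
    then show ?thesis using st by (simp add: powr_powr)
  qed
  finally show ?thesis by (simp add: potential_const_def N_def C_def V_def \<mu>_def w_def)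
qed

end

section \<open>The trace inequality for Riesz potentials\<close>

lemma (in morrey_density) potential_const_pos:
  assumes "\<gamma> * s < \<alpha>" "\<alpha> < \<alpha> * q * s + (\<alpha> * q - \<gamma>) * t"
  shows "0 < potential_const d \<alpha> q \<gamma> s t"
proof -
  have "0 < hedberg_const d \<alpha> (\<gamma> * s) (\<alpha> * q * s + (\<alpha> * q - \<gamma>) * t)"
    using assms exponents by (auto simp: hedberg_const_def intro!: mult_pos_pos add_pos_pos)
  moreover have "0 < unit_ball_vol d" by (simp add: dimension)
  ultimately show ?thesis
    unfolding potential_const_def using mean_const_pos by (intro mult_pos_pos) auto
qed

definition trace_const :: "real \<Rightarrow> real \<Rightarrow> real \<Rightarrow> real \<Rightarrow> real \<Rightarrow> real \<Rightarrow> real" where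
  "trace_const d \<alpha> p q \<gamma> \<delta> =
     potential_const d \<alpha> q \<gamma> 0 (\<alpha> / (\<alpha> * q - \<gamma>) + \<delta>) powr (p - 1) *
     potential_const d \<alpha> q \<gamma> (p / q) ((p - 1) * \<delta>)"

text \<open>
  Schur's test with \<open>u = W powr c\<close>, \<open>v = W powr \<delta>\<close>, where \<open>c = \<alpha> / \<mu> + \<delta>\<close>. The exponents match: for
  \<open>(s, t) = (0, c)\<close> the monomial estimate returns the exponent \<open>(\<mu> c - \<alpha>) / \<mu> = \<delta>\<close>, and for
  \<open>(s, t) = (p / q, (p - 1) \<delta>)\<close> it returns \<open>(p - 1) (\<alpha> / \<mu> + \<delta>) = c (p - 1)\<close>.
\<close>

lemma (in morrey_density) riesz_trace_inequality:
  assumes p: "1 < p" "p < q" and \<delta>: "0 < \<delta>" "\<alpha> / (\<alpha> * q - \<gamma>) + \<delta> < 1" "p / q + (p - 1) * \<delta> < 1"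
    and [measurable]: "f \<in> borel_measurable lebesgue"
    and f: "(\<integral>\<^sup>+y. ennreal (\<bar>f y\<bar> powr p) \<partial>lebesgue) < \<infinity>"
  shows "AE x in lebesgue. \<beta> x \<noteq> 0 \<longrightarrow> (\<integral>\<^sup>+y. ennreal (norm (x - y) powr (\<alpha> - d) * \<bar>f y\<bar>) \<partial>lebesgue) < \<infinity>"
    and "(\<integral>\<^sup>+x. ennreal (\<beta> x powr (p / q) *
             enn2real (\<integral>\<^sup>+y. ennreal (norm (x - y) powr (\<alpha> - d) * \<bar>f y\<bar>) \<partial>lebesgue) powr p) \<partial>lebesgue)
      \<le> ennreal (trace_const d \<alpha> p q \<gamma> \<delta>) * (\<integral>\<^sup>+y. ennreal (\<bar>f y\<bar> powr p) \<partial>lebesgue)"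
proof -
  define \<mu> where "\<mu> = \<alpha> * q - \<gamma>"
  define c where "c = \<alpha> / \<mu> + \<delta>"
  define \<kappa> where "\<kappa> = (p - 1) * \<delta>"
  have \<mu>: "0 < \<mu>" using exponents by (simp add: \<mu>_def)
  have c: "0 < c" "c < 1" "\<mu> * c = \<alpha> + \<mu> * \<delta>"
    using \<mu> exponents \<delta> by (auto simp: c_def \<mu>_def[symmetric] distrib_left intro!: add_pos_pos)
  have \<kappa>: "0 < \<kappa>" "p / q + \<kappa> < 1" using p \<delta> by (auto simp: \<kappa>_def)
  have row_range: "\<gamma> * 0 < \<alpha>" "\<alpha> < \<alpha> * q * 0 + \<mu> * c"
    using exponents c \<mu> \<delta> by auto
  have "\<alpha> < \<alpha> * p" using p exponents by simp
  moreover have "0 < \<mu> * \<kappa>" using \<mu> \<kappa> by simp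
  ultimately have "\<alpha> < \<alpha> * p + \<mu> * \<kappa>" by linarith
  then have col_range: "\<gamma> * (p / q) < \<alpha>" "\<alpha> < \<alpha> * q * (p / q) + \<mu> * \<kappa>"
    using exponents p mult_strict_mono[of \<gamma> \<alpha> "p / q" 1] by auto
  define C where "C = potential_const d \<alpha> q \<gamma> 0 c"
  define D where "D = potential_const d \<alpha> q \<gamma> (p / q) \<kappa>"
  have CD: "0 < C" "0 < D"
    using potential_const_pos row_range col_range by (auto simp: C_def D_def \<mu>_def)
  have trace: "trace_const d \<alpha> p q \<gamma> \<delta> = C powr (p - 1) * D"
    by (simp add: trace_const_def C_def D_def c_def \<kappa>_def \<mu>_def)
  define k where "k x y = norm (x - y) powr (\<alpha> - d)" for x y :: 'a
  have "(AE x in lebesgue. \<beta> x powr (p / q) \<noteq> 0 \<longrightarrow> (\<integral>\<^sup>+y. ennreal (k x y * \<bar>f y\<bar>) \<partial>lebesgue) < \<infinity>) \<and>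
    (\<integral>\<^sup>+x. ennreal (\<beta> x powr (p / q) * enn2real (\<integral>\<^sup>+y. ennreal (k x y * \<bar>f y\<bar>) \<partial>lebesgue) powr p) \<partial>lebesgue)
      \<le> ennreal (C powr (p - 1) * D) * (\<integral>\<^sup>+y. ennreal (\<bar>f y\<bar> powr p) \<partial>lebesgue)"
  \<comment> \<open>The weights must be positive; a zero of the potential forces the density to vanish.\<close>
  proof (cases "\<exists>x. potential x = 0")
    case True
    then have 0: "AE x in lebesgue. \<beta> x = 0" using density_zero_if_potential_zero by blast
    then have "(\<integral>\<^sup>+x. ennreal (\<beta> x powr (p / q) * enn2real (\<integral>\<^sup>+y. ennreal (k x y * \<bar>f y\<bar>) \<partial>lebesgue) powr p) \<partial>lebesgue)
      = (\<integral>\<^sup>+x. 0 \<partial>(lebesgue :: 'a measure))"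
      by (intro nn_integral_cong_AE) (auto elim!: eventually_mono)
    with 0 show ?thesis by (auto elim!: eventually_mono)
  next
    case False
    have pos: "AE x in lebesgue. 0 < weight x \<and> potential x < \<infinity>"
      using AE_potential_finite
    proof eventually_elim
      case (elim x)
      then show ?case using False by (auto simp: weight_def enn2real_positive_iff zero_less_iff_neq_zero)
    qed
    have row: "AE x in lebesgue. (\<integral>\<^sup>+y. ennreal (k x y) * ennreal (weight y powr c) \<partial>lebesgue) \<le> ennreal (C * weight x powr \<delta>)"
      using pos
    proof eventually_elim
      case (elim x)
      have "(\<alpha> * q * 0 + \<mu> * c - \<alpha>) / \<mu> = \<delta>" using c \<mu> by simp
      then show ?case
        using riesz_potential_monomial[of x 0 c, folded \<mu>_def] elim c row_range
        by (simp add: k_def C_def monomial_weight_def)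
    qed
    have col: "AE y in lebesgue. (\<integral>\<^sup>+x. ennreal (k x y) * ennreal (\<beta> x powr (p / q) * (weight x powr \<delta>) powr (p - 1)) \<partial>lebesgue)
       \<le> ennreal (D * (weight y powr c) powr (p - 1))"
      using pos
    proof eventually_elim
      case (elim y)
      have "(\<alpha> * q * (p / q) + \<mu> * \<kappa> - \<alpha>) / \<mu> = c * (p - 1)"
        using \<mu> p by (simp add: c_def \<kappa>_def field_simps)
      then show ?case
        using riesz_potential_monomial[of y "p / q" \<kappa>, folded \<mu>_def] elim \<kappa> p col_range
        by (simp add: k_def D_def monomial_weight_def norm_minus_commute powr_powr \<kappa>_def mult.commute)
    qed
    have [measurable]: "(\<lambda>z. k (fst z) (snd z)) \<in> borel_measurable (lebesgue \<Otimes>\<^sub>M lebesgue)"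
      unfolding k_def by measurable
    show ?thesis
      by (intro conjI schur_test[where p = p and C = C and D = D and u = "\<lambda>y. weight y powr c" and v = "\<lambda>x. weight x powr \<delta>"] row col
           sigma_finite_lebesgue CD f p(1))
         (use pos in \<open>auto simp: k_def elim!: eventually_mono\<close>)
  qed
  then show "AE x in lebesgue. \<beta> x \<noteq> 0 \<longrightarrow> (\<integral>\<^sup>+y. ennreal (norm (x - y) powr (\<alpha> - d) * \<bar>f y\<bar>) \<partial>lebesgue) < \<infinity>"
    "(\<integral>\<^sup>+x. ennreal (\<beta> x powr (p / q) *
             enn2real (\<integral>\<^sup>+y. ennreal (norm (x - y) powr (\<alpha> - d) * \<bar>f y\<bar>) \<partial>lebesgue) powr p) \<partial>lebesgue)
      \<le> ennreal (trace_const d \<alpha> p q \<gamma> \<delta>) * (\<integral>\<^sup>+y. ennreal (\<bar>f y\<bar> powr p) \<partial>lebesgue)"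
    by (simp_all add: k_def trace)
qed

section \<open>Morrey norms\<close>

lemma nn_integral_ball_le_morrey_norm:
  fixes b :: "'a::euclidean_space \<Rightarrow> real"
  defines "d \<equiv> real DIM('a)"
  assumes q: "0 < q" and K: "morrey_norm q \<alpha> b \<le> ennreal K" "0 < K" and \<rho>: "0 < \<rho>"
  shows "(\<integral>\<^sup>+z\<in>ball x \<rho>. ennreal (\<bar>b z\<bar> powr q) \<partial>lebesgue)
    \<le> ennreal (K powr q * unit_ball_vol d * \<rho> powr (d - \<alpha> * q))"
proof -
  define I where "I = (\<integral>\<^sup>+z\<in>ball x \<rho>. ennreal (\<bar>b z\<bar> powr q) \<partial>lebesgue)"
  define v where "v = unit_ball_vol d * \<rho> powr d"
  have v: "0 < v" using \<rho> by (simp add: v_def d_def)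
  have vol: "emeasure lebesgue (ball x \<rho>) = ennreal v"
    using \<rho> by (simp add: emeasure_ball_powr v_def d_def)
  have "ennreal (\<rho> powr \<alpha>) * normalized_norm q (ball x \<rho>) b \<le> ennreal (\<rho> powr \<alpha>) * (SUP x. normalized_norm q (ball x \<rho>) b)"
    by (intro mult_left_mono SUP_upper) auto
  also have "\<dots> \<le> morrey_norm q \<alpha> b"
    unfolding morrey_norm_def using \<rho> by (intro SUP_upper) auto
  finally have le: "ennreal (\<rho> powr \<alpha>) * ennreal_powr (I / ennreal v) (1 / q) \<le> ennreal K"
    using K(1) by (simp add: normalized_norm_def I_def vol)
  have fin: "I / ennreal v \<noteq> \<infinity>"
  proof
    assume "I / ennreal v = \<infinity>"
    with le \<rho> show False by (simp add: ennreal_powr_def ennreal_mult_top top_unique)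
  qed
  define i where "i = enn2real (I / ennreal v)"
  have I: "I / ennreal v = ennreal i" "0 \<le> i" using fin by (simp_all add: i_def less_top)
  have "ennreal (\<rho> powr \<alpha> * i powr (1 / q)) \<le> ennreal K"
    using le I by (simp add: ennreal_powr_def ennreal_mult)
  then have "\<rho> powr \<alpha> * i powr (1 / q) \<le> K" using K(2) by (simp add: ennreal_le_iff)
  then have "(\<rho> powr \<alpha> * i powr (1 / q)) powr q \<le> K powr q" using q by (intro powr_mono2) auto
  then have "\<rho> powr (\<alpha> * q) * i \<le> K powr q" using q I \<rho> by (simp add: powr_mult powr_powr)
  then have "i * v \<le> K powr q * \<rho> powr (-(\<alpha> * q)) * v"
    using \<rho> v by (intro mult_right_mono) (simp_all add: powr_minus field_simps)
  also have "\<dots> = K powr q * unit_ball_vol d * \<rho> powr (d - \<alpha> * q)"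
    using \<rho> by (simp add: v_def powr_diff powr_minus field_simps)
  finally have "ennreal (i * v) \<le> ennreal (K powr q * unit_ball_vol d * \<rho> powr (d - \<alpha> * q))"
    by (rule ennreal_leI)
  moreover have "I = ennreal (i * v)"
    using I v by (simp add: ennreal_mult'' I(1)[symmetric] ennreal_divide_times[symmetric])
      (simp add: ennreal_divide_times divide_mult_eq ennreal_mult_divide_eq)
  ultimately show ?thesis by (simp add: I_def)
qed

text \<open>
  The bound \<open>K\<close> is a strictly positive majorant of the Morrey norm rather than the norm itself, so
  that \<open>\<bar>b\<bar> powr q\<close> can be divided by \<open>K powr q\<close> even if the norm is \<open>0\<close>.
\<close>

lemma morrey_riesz_bound:
  fixes \<alpha> p q \<gamma> \<delta> K :: real and b f :: "'a::euclidean_space \<Rightarrow> real"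
  defines "d \<equiv> real DIM('a)"
  assumes \<gamma>: "0 < \<gamma>" "\<gamma> < \<alpha>" "\<alpha> < d" "\<gamma> < \<alpha> * q" and p: "1 < p" "p < q"
    and \<delta>: "0 < \<delta>" "\<alpha> / (\<alpha> * q - \<gamma>) + \<delta> < 1" "p / q + (p - 1) * \<delta> < 1"
    and [measurable]: "b \<in> borel_measurable lebesgue" "f \<in> borel_measurable lebesgue"
    and K: "morrey_norm q \<alpha> b \<le> ennreal K" "0 < K"
    and f: "(\<integral>\<^sup>+y. ennreal (\<bar>f y\<bar> powr p) \<partial>lebesgue) < \<infinity>"
  shows "AE x in lebesgue. b x \<noteq> 0 \<longrightarrow> integrable lebesgue (riesz_integrand \<alpha> f x)"
    and "(\<integral>\<^sup>+x. ennreal (\<bar>b x * riesz_potential \<alpha> f x\<bar> powr p) \<partial>lebesgue)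
      \<le> ennreal (trace_const d \<alpha> p q \<gamma> \<delta> * unit_ball_vol d powr (p / q) * K powr p) *
          (\<integral>\<^sup>+y. ennreal (\<bar>f y\<bar> powr p) \<partial>lebesgue)"
proof -
  define V where "V = unit_ball_vol d"
  define L where "L = K powr q * V"
  define \<beta> where "\<beta> x = \<bar>b x\<bar> powr q / L" for x
  have V: "0 < V" by (simp add: V_def d_def)
  have L: "0 < L" using V K by (simp add: L_def)
  have q: "0 < q" using p by simp
  interpret morrey_density \<beta> d \<alpha> q \<gamma>
  proof
    show "(\<integral>\<^sup>+z\<in>ball x \<rho>. ennreal (\<beta> z) \<partial>lebesgue) \<le> ennreal (\<rho> powr (d - \<alpha> * q))" if "0 < \<rho>" for x \<rho>
    proof -
      have "(\<integral>\<^sup>+z\<in>ball x \<rho>. ennreal (\<beta> z) \<partial>lebesgue)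
          = (\<integral>\<^sup>+z. ennreal (1 / L) * (ennreal (\<bar>b z\<bar> powr q) * indicator (ball x \<rho>) z) \<partial>lebesgue)"
        using L by (intro nn_integral_cong) (simp add: \<beta>_def ennreal_mult[symmetric] mult.assoc[symmetric])
      also have "\<dots> = ennreal (1 / L) * (\<integral>\<^sup>+z\<in>ball x \<rho>. ennreal (\<bar>b z\<bar> powr q) \<partial>lebesgue)"
        by (rule nn_integral_cmult) measurable
      also have "\<dots> \<le> ennreal (1 / L) * ennreal (L * \<rho> powr (d - \<alpha> * q))"
        unfolding L_def V_def d_def by (intro mult_left_mono nn_integral_ball_le_morrey_norm q K that) auto
      also have "\<dots> = ennreal (\<rho> powr (d - \<alpha> * q))"
        using L by (simp add: ennreal_mult[symmetric])
      finally show ?thesis .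
    qed
    show "\<beta> \<in> borel_measurable lebesgue" unfolding \<beta>_def by measurable
  qed (use \<gamma> L in \<open>auto simp: d_def \<beta>_def\<close>)
  define T where "T x = (\<integral>\<^sup>+y. ennreal (norm (x - y) powr (\<alpha> - d) * \<bar>f y\<bar>) \<partial>lebesgue)" for x
  have norm_integrand: "norm (riesz_integrand \<alpha> f x y) = norm (x - y) powr (\<alpha> - d) * \<bar>f y\<bar>" for x y
    using powr_minus_divide[of "norm (x - y)" "d - \<alpha>"] by (simp add: riesz_integrand_def d_def)
  have [measurable]: "riesz_integrand \<alpha> f x \<in> borel_measurable lebesgue" for x
    unfolding riesz_integrand_def by measurable
  have integrable: "integrable lebesgue (riesz_integrand \<alpha> f x)" if "T x < \<infinity>" for x
    using that by (intro integrableI_bounded) (simp_all only: norm_integrand T_def, measurable)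
  have finite: "AE x in lebesgue. b x \<noteq> 0 \<longrightarrow> T x < \<infinity>"
    using riesz_trace_inequality(1)[OF p \<delta> assms(12) f] L
    by (auto simp: T_def \<beta>_def elim!: eventually_mono)
  then show "AE x in lebesgue. b x \<noteq> 0 \<longrightarrow> integrable lebesgue (riesz_integrand \<alpha> f x)"
    by eventually_elim (use integrable in blast)
  have [measurable]: "T \<in> borel_measurable lebesgue" unfolding T_def by measurable
  have weight: "\<bar>b x\<bar> powr p = L powr (p / q) * \<beta> x powr (p / q)" for x
    using q L by (simp add: \<beta>_def powr_divide powr_powr)
  have "(\<integral>\<^sup>+x. ennreal (\<bar>b x * riesz_potential \<alpha> f x\<bar> powr p) \<partial>lebesgue)
      \<le> (\<integral>\<^sup>+x. ennreal (L powr (p / q)) * ennreal (\<beta> x powr (p / q) * enn2real (T x) powr p) \<partial>lebesgue)"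
  proof (intro nn_integral_mono_AE)
    show "AE x in lebesgue. ennreal (\<bar>b x * riesz_potential \<alpha> f x\<bar> powr p)
        \<le> ennreal (L powr (p / q)) * ennreal (\<beta> x powr (p / q) * enn2real (T x) powr p)"
      using finite
    proof eventually_elim
      case (elim x)
      show ?case
      proof (cases "b x = 0")
        case False
        then have T: "T x < \<infinity>" using elim by simp
        have "ennreal \<bar>riesz_potential \<alpha> f x\<bar> \<le> T x"
          using integral_norm_bound_ennreal[OF integrable[OF T]]
          by (simp add: riesz_potential_def T_def norm_integrand[simplified real_norm_def])
        then have "\<bar>riesz_potential \<alpha> f x\<bar> \<le> enn2real (T x)"
          using T by (metis abs_ge_zero enn2real_ennreal enn2real_mono infinity_ennreal_def)
        then have "\<bar>riesz_potential \<alpha> f x\<bar> powr p \<le> enn2real (T x) powr p"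
          using p by (intro powr_mono2) auto
        then have "\<bar>b x\<bar> powr p * \<bar>riesz_potential \<alpha> f x\<bar> powr p
            \<le> L powr (p / q) * (\<beta> x powr (p / q) * enn2real (T x) powr p)"
          unfolding weight mult.assoc[symmetric] by (intro mult_left_mono) auto
        then show ?thesis
          by (simp add: abs_mult powr_mult ennreal_mult[symmetric] ennreal_leI)
      qed simp
    qed
  qed
  also have "\<dots> = ennreal (L powr (p / q)) * (\<integral>\<^sup>+x. ennreal (\<beta> x powr (p / q) * enn2real (T x) powr p) \<partial>lebesgue)"
    by (rule nn_integral_cmult) measurable
  also have "\<dots> \<le> ennreal (L powr (p / q)) * (ennreal (trace_const d \<alpha> p q \<gamma> \<delta>) * (\<integral>\<^sup>+y. ennreal (\<bar>f y\<bar> powr p) \<partial>lebesgue))"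
    unfolding T_def by (intro mult_left_mono riesz_trace_inequality(2) p \<delta> f) auto
  also have "\<dots> = ennreal (L powr (p / q) * trace_const d \<alpha> p q \<gamma> \<delta>) * (\<integral>\<^sup>+y. ennreal (\<bar>f y\<bar> powr p) \<partial>lebesgue)"
    by (simp add: ennreal_mult' mult.assoc)
  also have "L powr (p / q) * trace_const d \<alpha> p q \<gamma> \<delta> = trace_const d \<alpha> p q \<gamma> \<delta> * V powr (p / q) * K powr p"
    using q V K by (simp add: L_def powr_mult powr_powr)
  finally show "(\<integral>\<^sup>+x. ennreal (\<bar>b x * riesz_potential \<alpha> f x\<bar> powr p) \<partial>lebesgue)
      \<le> ennreal (trace_const d \<alpha> p q \<gamma> \<delta> * unit_ball_vol d powr (p / q) * K powr p) *
          (\<integral>\<^sup>+y. ennreal (\<bar>f y\<bar> powr p) \<partial>lebesgue)"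
    by (simp add: V_def)
qed

lemma ennreal_powr_le_root:
  assumes "0 < p" "0 \<le> c" "X \<le> ennreal (c powr p) * Y"
  shows "ennreal_powr X (1 / p) \<le> ennreal c * ennreal_powr Y (1 / p)"
proof (cases "Y = \<infinity>")
  case True
  show ?thesis
  proof (cases "c = 0")
    case True
    then show ?thesis using assms by (simp add: ennreal_powr_def)
  next
    case False
    then show ?thesis using True assms(2) by (simp add: ennreal_powr_def ennreal_mult_top)
  qed
next
  case False
  then obtain y where y: "Y = ennreal y" "0 \<le> y" by (cases Y) auto
  have "X \<le> ennreal (c powr p * y)" using assms y by (simp add: ennreal_mult)
  then obtain x where x: "X = ennreal x" "0 \<le> x" "x \<le> c powr p * y"
    using y by (cases X) (auto simp: ennreal_le_iff top_unique)
  have "x powr (1 / p) \<le> (c powr p * y) powr (1 / p)"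
    using x assms by (intro powr_mono2) auto
  also have "\<dots> = c * y powr (1 / p)" using assms y by (simp add: powr_mult powr_powr)
  finally show ?thesis
    using x y assms by (simp add: ennreal_powr_def ennreal_mult[symmetric] ennreal_leI)
qed

theorem theorem2p1:
  fixes \<alpha> p q :: real
  assumes "CARD('n::finite) \<ge> 2"
    and "0 < \<alpha>" and "\<alpha> < real CARD('n)"
    and "1 < p" and "p < q"
  shows "\<exists>N::real. 0 \<le> N \<and>
    (\<forall>b \<in> morrey_space q \<alpha>. \<forall>f \<in> Lp_space p.
       (AE x in lebesgue. b x \<noteq> 0 \<longrightarrow> integrable lebesgue (riesz_integrand \<alpha> f (x :: real ^ 'n))) \<and>
       (\<lambda>x. b x * riesz_potential \<alpha> f x) \<in> Lp_space p \<and>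
       Lp_norm p (\<lambda>x. b x * riesz_potential \<alpha> f x)
         \<le> ennreal N * morrey_norm q \<alpha> b * Lp_norm p f)"
proof -
  define d where "d = real DIM(real ^ 'n)"
  \<comment> \<open>Any \<open>\<gamma> = \<alpha> \<eta>\<close> with \<open>\<eta> < min 1 (q - 1)\<close> gives \<open>\<gamma> < \<alpha> < \<mu>\<close>, which leaves room for a \<open>\<delta> > 0\<close>.\<close>
  define \<eta> where "\<eta> = (q - 1) / (2 * q)"
  define \<gamma> where "\<gamma> = \<alpha> * \<eta>"
  define \<mu> where "\<mu> = \<alpha> * q - \<gamma>"
  have q: "1 < q" using assms by simp
  have \<eta>: "0 < \<eta>" "\<eta> < 1" "\<eta> < q - 1"
    using q divide_strict_left_mono[of 1 "2 * q" "q - 1"] by (simp_all add: \<eta>_def)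
  have "\<mu> = \<alpha> * (q - \<eta>)" by (simp add: \<mu>_def \<gamma>_def algebra_simps)
  then have \<mu>: "\<alpha> < \<mu>" using assms \<eta> by simp
  have \<gamma>: "0 < \<gamma>" "\<gamma> < \<alpha>" "\<alpha> < d" "\<gamma> < \<alpha> * q"
    using assms \<eta> \<mu> by (simp_all add: d_def \<gamma>_def)
  define \<delta> where "\<delta> = min ((1 - \<alpha> / \<mu>) / 2) ((1 - p / q) / (2 * (p - 1)))"
  have gap: "0 < 1 - \<alpha> / \<mu>" "0 < 1 - p / q" using \<mu> assms by simp_all
  then have \<delta>: "0 < \<delta>" using assms by (simp add: \<delta>_def)
  have cancel: "r * (z / (2 * r)) = z / 2" if "0 < r" for r z :: real using that by simp
  have "(p - 1) * \<delta> \<le> (p - 1) * ((1 - p / q) / (2 * (p - 1)))"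
    using assms unfolding \<delta>_def by (intro mult_left_mono) auto
  also have "\<dots> = (1 - p / q) / 2" using assms by (intro cancel) simp
  finally have "(p - 1) * \<delta> \<le> (1 - p / q) / 2" .
  moreover have "\<delta> \<le> (1 - \<alpha> / \<mu>) / 2" unfolding \<delta>_def by (rule min.cobounded1)
  moreover have "x + y < 1" if "y \<le> (1 - x) / 2" "0 < 1 - x" for x y :: real
    using that by (simp add: field_simps)
  ultimately have \<delta>': "\<alpha> / (\<alpha> * q - \<gamma>) + \<delta> < 1" "p / q + (p - 1) * \<delta> < 1"
    using gap unfolding \<mu>_def[symmetric] by blast+
  define N where "N = (max 0 (trace_const d \<alpha> p q \<gamma> \<delta> * unit_ball_vol d powr (p / q))) powr (1 / p)"
  have N: "0 \<le> N" by (simp add: N_def)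
  have N_powr: "trace_const d \<alpha> p q \<gamma> \<delta> * unit_ball_vol d powr (p / q) \<le> N powr p"
    using assms by (simp add: N_def powr_powr)
  show ?thesis
  proof (intro exI[of _ N] conjI N ballI)
    fix b f :: "real ^ 'n \<Rightarrow> real"
    assume b: "b \<in> morrey_space q \<alpha>" and f: "f \<in> Lp_space p"
    have [measurable]: "b \<in> borel_measurable lebesgue" "f \<in> borel_measurable lebesgue"
      using b f by (simp_all add: morrey_space_def Lp_space_def)
    obtain K where K: "morrey_norm q \<alpha> b = ennreal K" "0 \<le> K"
      using b by (cases "morrey_norm q \<alpha> b") (auto simp: morrey_space_def)
    obtain F where F: "Lp_norm p f = ennreal F" "0 \<le> F"
      using f by (cases "Lp_norm p f") (auto simp: Lp_space_def)
    have "(\<integral>\<^sup>+y. ennreal (\<bar>f y\<bar> powr p) \<partial>lebesgue) < \<infinity>"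
      using F by (auto simp: Lp_norm_def ennreal_powr_def less_top split: if_splits)
    note bound = morrey_riesz_bound[where 'a = "real ^ 'n", folded d_def, OF \<gamma> assms(4,5) \<delta> \<delta>' _ _ _ _ this]
    have K_le: "morrey_norm q \<alpha> b \<le> ennreal (K + e)" if "0 < e" for e
      using K that by (simp add: ennreal_leI)
    show "AE x in lebesgue. b x \<noteq> 0 \<longrightarrow> integrable lebesgue (riesz_integrand \<alpha> f x)"
      using bound(1)[OF _ _ K_le[of 1]] K by simp
    \<comment> \<open>The bound holds for \<open>K + e\<close> in place of the norm \<open>K\<close>; the case \<open>K = 0\<close> follows by letting \<open>e\<close> tend to \<open>0\<close>.\<close>
    have norm_le: "Lp_norm p (\<lambda>x. b x * riesz_potential \<alpha> f x) \<le> ennreal (N * (K + e) * F)" if "0 < e" for e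
    proof -
      have "(\<integral>\<^sup>+x. ennreal (\<bar>b x * riesz_potential \<alpha> f x\<bar> powr p) \<partial>lebesgue)
          \<le> ennreal (trace_const d \<alpha> p q \<gamma> \<delta> * unit_ball_vol d powr (p / q) * (K + e) powr p) *
              (\<integral>\<^sup>+y. ennreal (\<bar>f y\<bar> powr p) \<partial>lebesgue)"
        using that K by (intro bound(2) K_le) auto
      also have "\<dots> \<le> ennreal ((N * (K + e)) powr p) * (\<integral>\<^sup>+y. ennreal (\<bar>f y\<bar> powr p) \<partial>lebesgue)"
        using N_powr N K that by (intro mult_right_mono ennreal_leI) (auto simp: powr_mult intro!: mult_right_mono)
      finally have "Lp_norm p (\<lambda>x. b x * riesz_potential \<alpha> f x) \<le> ennreal (N * (K + e)) * Lp_norm p f"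
        unfolding Lp_norm_def using assms N K that by (intro ennreal_powr_le_root) auto
      then show ?thesis using F N K that by (simp add: ennreal_mult)
    qed
    obtain G where G: "Lp_norm p (\<lambda>x. b x * riesz_potential \<alpha> f x) = ennreal G" "0 \<le> G"
      using norm_le[of 1] by (cases "Lp_norm p (\<lambda>x. b x * riesz_potential \<alpha> f x)") (auto simp: top_unique)
    have "G \<le> N * K * F + e" if "0 < e" for e
    proof -
      have NF: "0 \<le> N * F" using N F by simp
      have e: "0 < e / (N * F + 1)" using that NF by simp
      have "ennreal G \<le> ennreal (N * (K + e / (N * F + 1)) * F)"
        using norm_le[OF e] by (simp only: G(1))
      moreover have "0 \<le> N * (K + e / (N * F + 1)) * F"
        using e N K F by (intro mult_nonneg_nonneg add_nonneg_nonneg) auto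
      ultimately have "G \<le> N * (K + e / (N * F + 1)) * F"
        by (simp only: ennreal_le_iff)
      also have "\<dots> = N * K * F + e * ((N * F) / (N * F + 1))" by (simp add: algebra_simps)
      also have "\<dots> \<le> N * K * F + e * 1"
        using that NF by (intro add_left_mono mult_left_mono) auto
      finally show ?thesis by simp
    qed
    then have "G \<le> N * K * F" by (rule field_le_epsilon)
    then show "Lp_norm p (\<lambda>x. b x * riesz_potential \<alpha> f x) \<le> ennreal N * morrey_norm q \<alpha> b * Lp_norm p f"
      using G K F N by (simp add: ennreal_mult[symmetric] ennreal_leI)
    have "riesz_potential \<alpha> f \<in> borel_measurable lebesgue"
      unfolding riesz_potential_def riesz_integrand_def by measurable
    then have "(\<lambda>x. b x * riesz_potential \<alpha> f x) \<in> borel_measurable lebesgue" by measurable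
    then show "(\<lambda>x. b x * riesz_potential \<alpha> f x) \<in> Lp_space p"
      using G by (simp add: Lp_space_def)
  qed
qed

end
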